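(* Let $\varphi_\tau\in H$ and $f\in L^1([0,\tau],H)$ be such that $\psi(t)\in D(e^{\tau A})$ for each $t\in[0,\tau)$. Let $t\in[0,\tau)$, let $h_t:[0,\infty)\to(0,\infty)$ be a monotonically increasing continuous function with $h_t(\lambda)\to\infty$ as $\lambda\to\infty$ and $u(t)\in D(h_t(A))$, and let $\rho_t>0$ be such that $\|h_t(A)u(t)\|\le\rho_t$. Let $\tilde\varphi_\tau\in H$ and $\tilde f\in L^1([0,\tau],H)$ satisfy $\|\varphi_\tau-\tilde\varphi_\tau\|+\|f-\tilde f\|_1\le\delta$ for some noise level $\delta>0$. For $\lambda>0$ let $$\xi_t(\lambda):=h_t(\lambda)e^{(\tau-t)\lambda},$$ and let $$\beta=\beta_t(\delta):=\xi_t^{-1}(\rho_t/\delta).$$ Then $$\|u(t)-\tilde u_\beta(t)\|\le\frac{2\rho_t}{h_t(\xi_t^{-1}(\rho_t/\delta))} .$$ In particular, $$\|u(t)-\tilde u_\beta(t)\|\to0\quad\text{as}\quad\delta\to0.$$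
   Context: $H$ is a Hilbert space and $A:D(A)\subseteq H\to H$ is a densely defined positive self-adjoint (unbounded) operator, with spectral resolution $\{E_\lambda\}$ on $[0,\infty)$. For a continuous $g:[0,\infty)\to\mathbb{R}$, $g(A)\varphi=\int_0^\infty g(\lambda)\,dE_\lambda\varphi$ on $D(g(A))=\{\varphi\in H:\int_0^\infty |g(\lambda)|^2\,d\|E_\lambda\varphi\|^2<\infty\}$; in particular this defines $e^{rA}$ for every $r\in\mathbb{R}$. Fix $\tau>0$. Set $$\psi(t):=\varphi_\tau-\int_t^\tau e^{-(\tau-s)A}f(s)\,ds,\qquad \tilde\psi(t):=\tilde\varphi_\tau-\int_t^\tau e^{-(\tau-s)A}\tilde f(s)\,ds .$$ The mild solution of the final value problem $u'(t)+Au(t)=f(t)$ $(0\le t<\tau)$, $u(\tau)=\varphi_\tau$, is $u(t)=e^{(\tau-t)A}\psi(t)$, defined when $\psi(t)\in D(e^{(\tau-t)A})$. For $\beta>0$, the truncated spectral regularized solution with noisy data $(\tilde\varphi_\tau,\tilde f)$ is $\tilde u_\beta(t)=\int_0^\beta e^{(\tau-t)\lambda}\,dE_\lambda(\tilde\psi(t))$. $\|\cdot\|_1$ is the norm of $L^1([0,\tau],H)$. $\xi_t^{-1}$ denotes the inverse function of $\xi_t$. In the limit $\delta\to0$ the noisy data vary with $\delta$, subject to the stated noise bound. *)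

theory Defs
  imports "HOL-Analysis.Analysis"
begin

section \<open>Bochner integration without separability\<close>

text \<open>
  The library's Bochner integral requires a second countable range type. The notions below
  do not, so that the Hilbert space need not be separable; instead of Borel
  measurability one asks for strong measurability (almost everywhere limit of simple functions).
\<close>

definition strongly_measurable :: "'b measure \<Rightarrow> ('b \<Rightarrow> 'a::real_normed_vector) \<Rightarrow> bool" where
  "strongly_measurable M f \<longleftrightarrow>
     (\<exists>s :: nat \<Rightarrow> 'b \<Rightarrow> 'a. (\<forall>i. simple_function M (s i)) \<and>
        (AE x in M. (\<lambda>i. s i x) \<longlonglongrightarrow> f x))"

definition L1_function :: "'b measure \<Rightarrow> ('b \<Rightarrow> 'a::real_normed_vector) \<Rightarrow> bool" where
  "L1_function M f \<longleftrightarrow>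
     strongly_measurable M f \<and> (\<integral>\<^sup>+x. ennreal (norm (f x)) \<partial>M) < \<infinity>"

definition L1_norm :: "'b measure \<Rightarrow> ('b \<Rightarrow> 'a::real_normed_vector) \<Rightarrow> real" where
  "L1_norm M f = (LINT x|M. norm (f x))"

definition has_bochner_integral_strong ::
  "'b measure \<Rightarrow> ('b \<Rightarrow> 'a::real_normed_vector) \<Rightarrow> 'a \<Rightarrow> bool" where
  "has_bochner_integral_strong M f I \<longleftrightarrow>
     strongly_measurable M f \<and>
     (\<exists>s :: nat \<Rightarrow> 'b \<Rightarrow> 'a. (\<forall>i. Bochner_Integration.simple_bochner_integrable M (s i)) \<and>
        (\<lambda>i. \<integral>\<^sup>+x. ennreal (norm (f x - s i x)) \<partial>M) \<longlonglongrightarrow> 0 \<and>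
        (\<lambda>i. Bochner_Integration.simple_bochner_integral M (s i)) \<longlonglongrightarrow> I)"

definition bochner_integral :: "'b measure \<Rightarrow> ('b \<Rightarrow> 'a::real_normed_vector) \<Rightarrow> 'a" where
  "bochner_integral M f = (THE I. has_bochner_integral_strong M f I)"


section \<open>Unbounded operators and spectral resolutions\<close>

text \<open>
  An operator is given by its domain \<open>D\<close> and a function \<open>A\<close> whose values outside \<open>D\<close> are
  irrelevant. Scalars are real; for a complex Hilbert space take the inner product
  \<open>Re \<langle>x, y\<rangle>\<close>, which changes neither the norm nor the adjoint of a complex linear operator.
\<close>

definition linear_operator_on :: "'a::real_vector set \<Rightarrow> ('a \<Rightarrow> 'a) \<Rightarrow> bool" where
  "linear_operator_on D A \<longleftrightarrow>
     subspace D \<and> (\<forall>x\<in>D. \<forall>y\<in>D. A (x + y) = A x + A y) \<and> (\<forall>c. \<forall>x\<in>D. A (c *\<^sub>R x) = c *\<^sub>R A x)"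

text \<open>\<open>(y, z)\<close> lies in the graph of the adjoint of \<open>A\<close>.\<close>

definition adjoint_graph :: "'a::real_inner set \<Rightarrow> ('a \<Rightarrow> 'a) \<Rightarrow> ('a \<times> 'a) set" where
  "adjoint_graph D A = {(y, z). \<forall>x\<in>D. A x \<bullet> y = x \<bullet> z}"

definition positive_selfadjoint :: "'a::real_inner set \<Rightarrow> ('a \<Rightarrow> 'a) \<Rightarrow> bool" where
  "positive_selfadjoint D A \<longleftrightarrow>
     linear_operator_on D A \<and> closure D = UNIV \<and>
     adjoint_graph D A = {(y, A y) | y. y \<in> D} \<and>
     (\<forall>x\<in>D. A x \<bullet> x \<ge> 0)"

definition orthogonal_projection :: "('a::real_inner \<Rightarrow> 'a) \<Rightarrow> bool" where
  "orthogonal_projection P \<longleftrightarrow>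
     bounded_linear P \<and> (\<forall>x. P (P x) = P x) \<and> (\<forall>x y. P x \<bullet> y = x \<bullet> P y)"

text \<open>
  Right continuous resolution of the identity, supported on \<open>[0,\<infinity>)\<close>. The projection \<open>E 0\<close>
  may be nonzero: it is the atom at \<open>0\<close>.
\<close>

definition resolution_of_identity :: "(real \<Rightarrow> 'a::real_inner \<Rightarrow> 'a) \<Rightarrow> bool" where
  "resolution_of_identity E \<longleftrightarrow>
     (\<forall>l. orthogonal_projection (E l)) \<and>
     (\<forall>l m x. E l (E m x) = E (min l m) x) \<and>
     (\<forall>l<0. \<forall>x. E l x = 0) \<and>
     (\<forall>l x. ((\<lambda>m. E m x) \<longlongrightarrow> E l x) (at_right l)) \<and>
     (\<forall>x. ((\<lambda>m. E m x) \<longlongrightarrow> x) at_top)"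

text \<open>
  Riemann-Stieltjes integral of \<open>g\<close> against a vector valued \<open>F\<close> over \<open>[a,b]\<close>, as the norm limit
  of tagged sums when the mesh tends to \<open>0\<close>.
\<close>

definition has_RS_integral ::
  "(real \<Rightarrow> real) \<Rightarrow> (real \<Rightarrow> 'a::real_normed_vector) \<Rightarrow> real \<Rightarrow> real \<Rightarrow> 'a \<Rightarrow> bool" where
  "has_RS_integral g F a b I \<longleftrightarrow>
     (\<forall>e>0. \<exists>d>0. \<forall>p. p tagged_division_of {a..b} \<and> (\<lambda>x. ball x d) fine p \<longrightarrow>
        norm ((\<Sum>(x, K)\<in>p. g x *\<^sub>R (F (Sup K) - F (Inf K))) - I) < e)"

definition RS_integral ::
  "(real \<Rightarrow> real) \<Rightarrow> (real \<Rightarrow> 'a::real_normed_vector) \<Rightarrow> real \<Rightarrow> real \<Rightarrow> 'a" where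
  "RS_integral g F a b = (THE I. has_RS_integral g F a b I)"

text \<open>
  \<open>spectral_integral_upto E g b x\<close> is the integral of \<open>g(\<lambda>) dE\<^sub>\<lambda> x\<close> over the closed interval
  \<open>[0,b]\<close>. The Riemann-Stieltjes integral only sees \<open>(0,b]\<close>; the first summand
  is the contribution of the atom at \<open>0\<close>.
\<close>

definition spectral_integral_upto ::
  "(real \<Rightarrow> 'a::real_inner \<Rightarrow> 'a) \<Rightarrow> (real \<Rightarrow> real) \<Rightarrow> real \<Rightarrow> 'a \<Rightarrow> 'a" where
  "spectral_integral_upto E g b x = g 0 *\<^sub>R E 0 x + RS_integral g (\<lambda>l. E l x) 0 b"

text \<open>\<open>g(A)\<close>, given through the resolution \<open>E\<close> of \<open>A\<close>, and its domain.\<close>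

definition spectral_integral ::
  "(real \<Rightarrow> 'a::real_inner \<Rightarrow> 'a) \<Rightarrow> (real \<Rightarrow> real) \<Rightarrow> 'a \<Rightarrow> 'a" where
  "spectral_integral E g x = Lim at_top (\<lambda>b. spectral_integral_upto E g b x)"

definition spectral_domain ::
  "(real \<Rightarrow> 'a::real_inner \<Rightarrow> 'a) \<Rightarrow> (real \<Rightarrow> real) \<Rightarrow> 'a set" where
  "spectral_domain E g =
     {x. (\<integral>\<^sup>+l\<in>{0..}. ennreal (\<bar>g l\<bar>\<^sup>2) \<partial>interval_measure (\<lambda>l. (norm (E l x))\<^sup>2)) < \<infinity>}"

definition spectral_resolution_of ::
  "'a::real_inner set \<Rightarrow> ('a \<Rightarrow> 'a) \<Rightarrow> (real \<Rightarrow> 'a \<Rightarrow> 'a) \<Rightarrow> bool" where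
  "spectral_resolution_of D A E \<longleftrightarrow>
     resolution_of_identity E \<and> D = spectral_domain E (\<lambda>l. l) \<and>
     (\<forall>x\<in>D. A x = spectral_integral E (\<lambda>l. l) x)"


section \<open>The final value problem\<close>

text \<open>The operator \<open>exp (r A)\<close> and its domain.\<close>

definition exp_op :: "(real \<Rightarrow> 'a::real_inner \<Rightarrow> 'a) \<Rightarrow> real \<Rightarrow> 'a \<Rightarrow> 'a" where
  "exp_op E r = spectral_integral E (\<lambda>l. exp (r * l))"

definition exp_dom :: "(real \<Rightarrow> 'a::real_inner \<Rightarrow> 'a) \<Rightarrow> real \<Rightarrow> 'a set" where
  "exp_dom E r = spectral_domain E (\<lambda>l. exp (r * l))"

text \<open>The function \<open>\<psi>\<close> built from final value \<open>\<phi>\<close> and source \<open>f\<close>.\<close>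

definition final_psi ::
  "(real \<Rightarrow> 'a::real_inner \<Rightarrow> 'a) \<Rightarrow> real \<Rightarrow> 'a \<Rightarrow> (real \<Rightarrow> 'a) \<Rightarrow> real \<Rightarrow> 'a" where
  "final_psi E \<tau> \<phi> f t =
     \<phi> - bochner_integral (lebesgue_on {t..\<tau>}) (\<lambda>s. exp_op E (- (\<tau> - s)) (f s))"

definition mild_solution ::
  "(real \<Rightarrow> 'a::real_inner \<Rightarrow> 'a) \<Rightarrow> real \<Rightarrow> 'a \<Rightarrow> (real \<Rightarrow> 'a) \<Rightarrow> real \<Rightarrow> 'a" where
  "mild_solution E \<tau> \<phi> f t = exp_op E (\<tau> - t) (final_psi E \<tau> \<phi> f t)"

definition truncated_solution ::
  "(real \<Rightarrow> 'a::real_inner \<Rightarrow> 'a) \<Rightarrow> real \<Rightarrow> 'a \<Rightarrow> (real \<Rightarrow> 'a) \<Rightarrow> real \<Rightarrow> real \<Rightarrow> 'a" where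
  "truncated_solution E \<tau> \<phi> f \<beta> t =
     spectral_integral_upto E (\<lambda>l. exp ((\<tau> - t) * l)) \<beta> (final_psi E \<tau> \<phi> f t)"

definition xi :: "real \<Rightarrow> real \<Rightarrow> (real \<Rightarrow> real) \<Rightarrow> real \<Rightarrow> real" where
  "xi \<tau> t h l = h l * exp ((\<tau> - t) * l)"

text \<open>
  The inverse of \<open>xi\<close> as a function on \<open>(0,\<infinity>)\<close>; it is meaningful only for arguments in the
  range \<open>xi \<tau> t h ` {0<..}\<close>, which is the interval \<open>(h 0, \<infinity>)\<close>.
\<close>

definition xi_inv :: "real \<Rightarrow> real \<Rightarrow> (real \<Rightarrow> real) \<Rightarrow> real \<Rightarrow> real" where
  "xi_inv \<tau> t h = the_inv_into {0<..} (xi \<tau> t h)"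

end

(* Let \<mu> be the measure with distribution function |E_l x|^2. The increments of E x over half-open
   intervals satisfy <E(a,b]x, E(c,d]x> = \<mu>((a,b] \<inter> (c,d]), so s \<mapsto> \<integral> s dE x is an isometry from
   step functions with the L^2(\<mu>) norm to the Hilbert space. This gives existence and norms of all
   the Riemann-Stieltjes integrals, and E_\<beta> g(A)x is the integral of g over [0,\<beta>].

   With u the mild solution, u - u~_\<beta> splits into u - E_\<beta> u and the integral of exp((\<tau>-t)l) over [0,\<beta>]
   applied to \<psi>(t) - \<psi>~(t). The first part has norm at most \<rho>/h(\<beta>) because h \<ge> h(\<beta>) above \<beta>.
   The second has norm at most exp((\<tau>-t)\<beta>) \<delta> because the semigroup exp(-rA) is contractive, so
   that |\<psi>(t) - \<psi>~(t)| \<le> \<delta>. The choice \<xi>(\<beta>) = \<rho>/\<delta> makes the two bounds equal. *)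

theory Submission
  imports Defs
begin

section \<open>Bochner integrals of strongly measurable functions\<close>

text \<open>\<open>bochner_integral\<close>, \<open>RS_integral\<close> and
  \<open>spectral_integral\<close> are defined by \<open>THE\<close> or \<open>Lim\<close>, so they
  carry no information until their values are shown to exist; much of the work goes there. Two
  obstacles shape it. First, H may be nonseparable, so the integral in \<open>final_psi\<close>
  lives on strongly measurable functions, which are only almost everywhere limits of simple
  functions; completeness of Lebesgue measure makes their norms Borel measurable. The integrand
  built from the semigroup and f must itself be shown to be strongly measurable. Second, h and the
  growing exponential are unbounded, while the isometry is developed for bounded limits of step
  functions. Statements about functions of A are therefore checked after applying
  \<open>E b\<close>, which cuts the integrand off at b; since \<open>E b y\<close> tends to y as b
  grows, identities and norm bounds survive removal of the cutoff. For \<delta> -> 0, the error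
  bound involves the noisy data only through \<delta>, so the data may vary arbitrarily with
  \<delta>; what remains is that \<open>xi_inv\<close> tends to infinity.\<close>

lemma simple_function_norm_measurable:
  "simple_function M s \<Longrightarrow> (\<lambda>x. norm (s x)) \<in> borel_measurable M"
  by (rule borel_measurable_simple_function) (rule simple_function_compose1)

lemma simple_function_diff:
  fixes s :: "'b \<Rightarrow> 'a::real_normed_vector"
  shows "simple_function M s \<Longrightarrow> simple_function M s' \<Longrightarrow> simple_function M (\<lambda>x. s x - s' x)"
  by (rule simple_function_compose2)

lemma strongly_measurable_simple:
  "simple_function M s \<Longrightarrow> strongly_measurable M s"
  unfolding strongly_measurable_def by (intro exI[of _ "\<lambda>_. s"]) simp

lemma strongly_measurable_diff:
  fixes f g :: "'b \<Rightarrow> 'a::real_normed_vector"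
  assumes "strongly_measurable M f" "strongly_measurable M g"
  shows "strongly_measurable M (\<lambda>x. f x - g x)"
proof -
  obtain s where s: "\<forall>i. simple_function M (s i)" "AE x in M. (\<lambda>i. s i x) \<longlonglongrightarrow> f x"
    using assms(1) unfolding strongly_measurable_def by blast
  obtain s' where s': "\<forall>i. simple_function M (s' i)" "AE x in M. (\<lambda>i. s' i x) \<longlonglongrightarrow> g x"
    using assms(2) unfolding strongly_measurable_def by blast
  have "AE x in M. (\<lambda>i. s i x - s' i x) \<longlonglongrightarrow> f x - g x"
    using s(2) s'(2) by eventually_elim (rule tendsto_diff)
  then show ?thesis unfolding strongly_measurable_def
    using s(1) s'(1) by (intro exI[of _ "\<lambda>i x. s i x - s' i x"]) (simp add: simple_function_diff)
qed

text \<open>Off a null set N the convergence is pointwise, so f changed to 0 on N is measurable. The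
  part of a preimage inside N is a subset of a null set, hence measurable by completeness.\<close>

lemma (in complete_measure) borel_measurable_AE_LIMSEQ:
  fixes f :: "'a \<Rightarrow> real"
  assumes u: "\<And>i::nat. u i \<in> borel_measurable M" and lim: "AE x in M. (\<lambda>i. u i x) \<longlonglongrightarrow> f x"
  shows "f \<in> borel_measurable M"
proof -
  obtain N where N: "{x\<in>space M. \<not> (\<lambda>i. u i x) \<longlonglongrightarrow> f x} \<subseteq> N" "N \<in> null_sets M"
    using lim by (auto elim!: AE_E)
  have g: "(\<lambda>x. if x \<in> N then 0 else f x) \<in> borel_measurable M"
  proof (rule borel_measurable_LIMSEQ_metric)
    show "(\<lambda>x. if x \<in> N then 0 else u i x) \<in> borel_measurable M" for i
      using u N(2) by (intro measurable_If) (auto simp: null_sets_def)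
    show "(\<lambda>i. if x \<in> N then 0 else u i x) \<longlonglongrightarrow> (if x \<in> N then 0 else f x)" if "x \<in> space M" for x
      using that N(1) by auto
  qed
  show ?thesis
  proof (rule measurableI)
    fix A :: "real set" assume A: "A \<in> sets borel"
    have 1: "(\<lambda>x. if x \<in> N then 0 else f x) -` A \<inter> space M - N \<in> sets M"
      using measurable_sets[OF g A] N(2) by auto
    have "f -` A \<inter> space M \<inter> N \<in> sets M"
      using N(2) by (intro complete[of _ N]) auto
    moreover have "f -` A \<inter> space M
        = ((\<lambda>x. if x \<in> N then 0 else f x) -` A \<inter> space M - N) \<union> (f -` A \<inter> space M \<inter> N)"
      by auto
    ultimately show "f -` A \<inter> space M \<in> sets M" using 1 by (metis sets.Un)
  qed simp
qed

lemma complete_measure_lebesgue_on: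
  assumes "S \<in> sets lebesgue"
  shows "complete_measure (lebesgue_on S)"
proof
  fix A B :: "'a set" assume AB: "B \<subseteq> A" "A \<in> null_sets (lebesgue_on S)"
  then have A: "A \<in> null_sets lebesgue" "A \<subseteq> S"
    using assms by (auto simp: null_sets_restrict_space)
  then have "B \<in> sets lebesgue"
    using completion.complete[OF AB(1)] by auto
  then show "B \<in> sets (lebesgue_on S)"
    using A AB assms by (auto simp: sets_restrict_space_iff)
qed

text \<open>Additivity of the nonnegative integral needs measurable integrands; this provides them,
  for f itself and for the errors \<open>f x - s i x\<close>.\<close>

lemma (in complete_measure) strongly_measurable_norm:
  assumes "strongly_measurable M f"
  shows "(\<lambda>x. norm (f x)) \<in> borel_measurable M"
proof -
  obtain s where s: "\<forall>i. simple_function M (s i)" "AE x in M. (\<lambda>i. s i x) \<longlonglongrightarrow> f x"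
    using assms unfolding strongly_measurable_def by blast
  show ?thesis
  proof (rule borel_measurable_AE_LIMSEQ)
    show "AE x in M. (\<lambda>i. norm (s i x)) \<longlonglongrightarrow> norm (f x)"
      using s(2) by eventually_elim (rule tendsto_norm)
  qed (use s(1) in \<open>simp add: simple_function_norm_measurable\<close>)
qed

lemma (in complete_measure) L1_function_diff:
  fixes f g :: "'a \<Rightarrow> 'c::real_normed_vector"
  assumes f: "L1_function M f" and g: "L1_function M g"
  shows "L1_function M (\<lambda>x. f x - g x)"
proof -
  have [measurable]: "(\<lambda>x. norm (f x)) \<in> borel_measurable M" "(\<lambda>x. norm (g x)) \<in> borel_measurable M"
    using f g by (auto simp: L1_function_def intro: strongly_measurable_norm)
  have "(\<integral>\<^sup>+x. ennreal (norm (f x - g x)) \<partial>M) \<le> (\<integral>\<^sup>+x. ennreal (norm (f x)) + ennreal (norm (g x)) \<partial>M)"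
    by (intro nn_integral_mono) (simp flip: ennreal_plus add: norm_triangle_ineq4)
  also have "\<dots> = (\<integral>\<^sup>+x. ennreal (norm (f x)) \<partial>M) + (\<integral>\<^sup>+x. ennreal (norm (g x)) \<partial>M)"
    by (rule nn_integral_add) auto
  also have "\<dots> < \<infinity>" using f g by (simp add: L1_function_def)
  finally show ?thesis using f g by (simp add: L1_function_def strongly_measurable_diff)
qed

lemma (in complete_measure) ennreal_L1_norm:
  assumes "L1_function M f"
  shows "ennreal (L1_norm M f) = (\<integral>\<^sup>+x. ennreal (norm (f x)) \<partial>M)"
proof -
  have "integrable M (\<lambda>x. norm (f x))"
    using assms strongly_measurable_norm[of f] by (simp add: L1_function_def integrable_iff_bounded)
  then show ?thesis unfolding L1_norm_def by (subst nn_integral_eq_integral) auto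
qed

section \<open>Norm bound, uniqueness and existence of the Bochner integral\<close>

lemma norm_simple_bochner_integral_le:
  assumes s: "Bochner_Integration.simple_bochner_integrable M s"
  shows "ennreal (norm (Bochner_Integration.simple_bochner_integral M s)) \<le> (\<integral>\<^sup>+x. ennreal (norm (s x)) \<partial>M)"
proof -
  have "ennreal (norm (Bochner_Integration.simple_bochner_integral M s))
      \<le> ennreal (Bochner_Integration.simple_bochner_integral M (\<lambda>x. norm (s x)))"
    by (intro ennreal_leI simple_bochner_integral_norm_bound s)
  also have "\<dots> = (\<integral>\<^sup>+x. ennreal (norm (s x)) \<partial>M)"
    using simple_bochner_integrable_compose2[of "\<lambda>x y. norm x" M s s] s
    by (intro simple_bochner_integral_eq_nn_integral) auto
  finally show ?thesis .
qed

text \<open>For the simple approximants the bound holds up to the integral of the approximation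
  error, which vanishes in the limit. Applied to differences, it yields uniqueness and the
  dependence on the source term.\<close>

lemma (in complete_measure) has_bochner_integral_strong_norm_le:
  assumes "has_bochner_integral_strong M f I"
  shows "ennreal (norm I) \<le> (\<integral>\<^sup>+x. ennreal (norm (f x)) \<partial>M)"
proof -
  obtain s where s: "\<And>i. Bochner_Integration.simple_bochner_integrable M (s i)"
    and lim: "(\<lambda>i. \<integral>\<^sup>+x. ennreal (norm (f x - s i x)) \<partial>M) \<longlonglongrightarrow> 0"
    and I: "(\<lambda>i. Bochner_Integration.simple_bochner_integral M (s i)) \<longlonglongrightarrow> I"
    using assms unfolding has_bochner_integral_strong_def by blast
  have f: "strongly_measurable M f" using assms unfolding has_bochner_integral_strong_def by blast
  have sf: "simple_function M (s i)" for i using s[of i] by (auto elim: Bochner_Integration.simple_bochner_integrable.cases)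
  have [measurable]: "(\<lambda>x. norm (f x)) \<in> borel_measurable M" "(\<lambda>x. norm (f x - s i x)) \<in> borel_measurable M" for i
    using f sf by (auto intro: strongly_measurable_norm strongly_measurable_norm[OF strongly_measurable_diff[OF _ strongly_measurable_simple]])
  have le: "ennreal (norm (Bochner_Integration.simple_bochner_integral M (s i)))
      \<le> (\<integral>\<^sup>+x. ennreal (norm (f x - s i x)) \<partial>M) + (\<integral>\<^sup>+x. ennreal (norm (f x)) \<partial>M)" for i
  proof -
    have "ennreal (norm (Bochner_Integration.simple_bochner_integral M (s i))) \<le> (\<integral>\<^sup>+x. ennreal (norm (s i x)) \<partial>M)"
      by (rule norm_simple_bochner_integral_le[OF s])
    also have "\<dots> \<le> (\<integral>\<^sup>+x. ennreal (norm (f x - s i x)) + ennreal (norm (f x)) \<partial>M)"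
      by (intro nn_integral_mono)
         (simp flip: ennreal_plus, metis add.commute norm_minus_commute norm_triangle_sub)
    also have "\<dots> = (\<integral>\<^sup>+x. ennreal (norm (f x - s i x)) \<partial>M) + (\<integral>\<^sup>+x. ennreal (norm (f x)) \<partial>M)"
      by (rule nn_integral_add) auto
    finally show ?thesis .
  qed
  have "(\<lambda>i. ennreal (norm (Bochner_Integration.simple_bochner_integral M (s i)))) \<longlonglongrightarrow> ennreal (norm I)"
    by (intro tendsto_ennrealI tendsto_norm I)
  moreover have "(\<lambda>i. (\<integral>\<^sup>+x. ennreal (norm (f x - s i x)) \<partial>M) + (\<integral>\<^sup>+x. ennreal (norm (f x)) \<partial>M))
      \<longlonglongrightarrow> 0 + (\<integral>\<^sup>+x. ennreal (norm (f x)) \<partial>M)"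
    by (intro tendsto_add lim tendsto_const)
  ultimately show ?thesis
    using LIMSEQ_le le by fastforce
qed

lemma (in complete_measure) has_bochner_integral_strong_diff:
  fixes f g :: "'a \<Rightarrow> 'c::real_normed_vector"
  assumes f: "has_bochner_integral_strong M f I" and g: "has_bochner_integral_strong M g J"
  shows "has_bochner_integral_strong M (\<lambda>x. f x - g x) (I - J)"
proof -
  obtain s where s: "\<And>i. Bochner_Integration.simple_bochner_integrable M (s i)"
    and slim: "(\<lambda>i. \<integral>\<^sup>+x. ennreal (norm (f x - s i x)) \<partial>M) \<longlonglongrightarrow> 0"
    and I: "(\<lambda>i. Bochner_Integration.simple_bochner_integral M (s i)) \<longlonglongrightarrow> I"
    using f unfolding has_bochner_integral_strong_def by blast
  obtain r where r: "\<And>i. Bochner_Integration.simple_bochner_integrable M (r i)"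
    and rlim: "(\<lambda>i. \<integral>\<^sup>+x. ennreal (norm (g x - r i x)) \<partial>M) \<longlonglongrightarrow> 0"
    and J: "(\<lambda>i. Bochner_Integration.simple_bochner_integral M (r i)) \<longlonglongrightarrow> J"
    using g unfolding has_bochner_integral_strong_def by blast
  have fg: "strongly_measurable M f" "strongly_measurable M g"
    using f g unfolding has_bochner_integral_strong_def by auto
  have sf: "simple_function M (s i)" "simple_function M (r i)" for i
    using s[of i] r[of i] by (auto elim: Bochner_Integration.simple_bochner_integrable.cases)
  have [measurable]: "(\<lambda>x. norm (f x - s i x)) \<in> borel_measurable M" "(\<lambda>x. norm (g x - r i x)) \<in> borel_measurable M" for i
    using fg sf by (auto intro: strongly_measurable_norm[OF strongly_measurable_diff[OF _ strongly_measurable_simple]])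
  have le: "(\<integral>\<^sup>+x. ennreal (norm (f x - g x - (s i x - r i x))) \<partial>M)
      \<le> (\<integral>\<^sup>+x. ennreal (norm (f x - s i x)) \<partial>M) + (\<integral>\<^sup>+x. ennreal (norm (g x - r i x)) \<partial>M)" for i
  proof -
    have "norm (f x - g x - (s i x - r i x)) \<le> norm (f x - s i x) + norm (g x - r i x)" for x
      using norm_triangle_ineq4[of "f x - s i x" "g x - r i x"] by (simp add: algebra_simps)
    then have "(\<integral>\<^sup>+x. ennreal (norm (f x - g x - (s i x - r i x))) \<partial>M)
        \<le> (\<integral>\<^sup>+x. ennreal (norm (f x - s i x)) + ennreal (norm (g x - r i x)) \<partial>M)"
      by (intro nn_integral_mono) (simp flip: ennreal_plus)
    also have "\<dots> = (\<integral>\<^sup>+x. ennreal (norm (f x - s i x)) \<partial>M) + (\<integral>\<^sup>+x. ennreal (norm (g x - r i x)) \<partial>M)"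
      by (rule nn_integral_add) auto
    finally show ?thesis .
  qed
  have lim: "(\<lambda>i. \<integral>\<^sup>+x. ennreal (norm (f x - g x - (s i x - r i x))) \<partial>M) \<longlonglongrightarrow> 0"
  proof (rule tendsto_sandwich[OF _ _ tendsto_const])
    show "(\<lambda>i. (\<integral>\<^sup>+x. ennreal (norm (f x - s i x)) \<partial>M) + (\<integral>\<^sup>+x. ennreal (norm (g x - r i x)) \<partial>M)) \<longlonglongrightarrow> 0"
      using tendsto_add[OF slim rlim] by simp
  qed (use le in auto)
  have "(\<lambda>i. Bochner_Integration.simple_bochner_integral M (\<lambda>x. s i x - r i x)) \<longlonglongrightarrow> I - J"
    using tendsto_diff[OF I J] by (simp add: simple_bochner_integral_diff[OF s r])
  then show ?thesis unfolding has_bochner_integral_strong_def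
    using fg lim simple_bochner_integrable_compose2[of "(-)", OF _ s r]
    by (intro conjI exI[of _ "\<lambda>i x. s i x - r i x"] strongly_measurable_diff) auto
qed

lemma (in complete_measure) has_bochner_integral_strong_unique:
  assumes "has_bochner_integral_strong M f I" "has_bochner_integral_strong M f J"
  shows "I = J"
  using has_bochner_integral_strong_norm_le[OF has_bochner_integral_strong_diff[OF assms]] by simp

text \<open>On a finite measure space every simple function is integrable, so only convergence in L1
  has to be arranged; the integrals of the approximants are then Cauchy.\<close>

lemma (in complete_measure) L1_function_has_bochner_integral_strong:
  fixes f :: "'a \<Rightarrow> 'c::banach"
  assumes "finite_measure M" and f: "L1_function M f"
  shows "\<exists>I. has_bochner_integral_strong M f I"
proof -
  interpret finite_measure M by fact
  have sm: "strongly_measurable M f" and fin: "(\<integral>\<^sup>+x. ennreal (norm (f x)) \<partial>M) < \<infinity>"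
    using f by (auto simp: L1_function_def)
  have [measurable]: "(\<lambda>x. norm (f x)) \<in> borel_measurable M" using sm by (rule strongly_measurable_norm)
  obtain u where u: "\<And>i. simple_function M (u i)" "AE x in M. (\<lambda>i. u i x) \<longlonglongrightarrow> f x"
    using sm unfolding strongly_measurable_def by blast
  have [measurable]: "(\<lambda>x. norm (u i x)) \<in> borel_measurable M" for i
    using u(1) by (rule simple_function_norm_measurable)
  \<comment> \<open>The cutoff gives the integrable majorant 3 |f| for |f - s i|. The factor 2
    exceeds 1, so where f x is nonzero, u i x is eventually kept; where f x = 0, the truncated value
    is 0 as well.\<close>
  define s where "s i x = (if norm (u i x) \<le> 2 * norm (f x) then u i x else 0)" for i x
  have sf: "simple_function M (s i)" for i
    unfolding s_def by (intro simple_function_If u(1) simple_function_const) measurable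
  have s: "Bochner_Integration.simple_bochner_integrable M (s i)" for i
    using sf by (intro Bochner_Integration.simple_bochner_integrable.intros) auto
  have meas [measurable]: "(\<lambda>x. norm (f x - s i x)) \<in> borel_measurable M" for i
    by (rule strongly_measurable_norm[OF strongly_measurable_diff[OF sm strongly_measurable_simple[OF sf]]])
  have ae: "AE x in M. (\<lambda>i. s i x) \<longlonglongrightarrow> f x"
    using u(2)
  proof eventually_elim
    case (elim x)
    show ?case
    proof (cases "f x = 0")
      case True
      then have "s i x = 0" for i by (simp add: s_def)
      with True show ?thesis by simp
    next
      case False
      then have "norm (f x) < 2 * norm (f x)" by simp
      then have "eventually (\<lambda>i. norm (u i x) < 2 * norm (f x)) sequentially"
        using tendsto_norm[OF elim] by (rule order_tendstoD(2)[rotated])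
      then have "eventually (\<lambda>i. u i x = s i x) sequentially"
        by eventually_elim (simp add: s_def)
      with elim show ?thesis by (rule Lim_transform_eventually)
    qed
  qed
  have lim: "(\<lambda>i. \<integral>\<^sup>+x. ennreal (norm (f x - s i x)) \<partial>M) \<longlonglongrightarrow> (\<integral>\<^sup>+x. 0 \<partial>M)"
  proof (rule nn_integral_dominated_convergence[where w="\<lambda>x. ennreal (3 * norm (f x))"])
    show "(\<integral>\<^sup>+x. ennreal (3 * norm (f x)) \<partial>M) < \<infinity>"
      using fin by (simp add: ennreal_mult nn_integral_cmult ennreal_mult_less_top)
    have "norm (f x - s i x) \<le> 3 * norm (f x)" for i x
      using norm_triangle_ineq4[of "f x" "s i x"] by (auto simp: s_def split: if_splits)
    then show "AE x in M. ennreal (norm (f x - s i x)) \<le> ennreal (3 * norm (f x))" for i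
      by (intro AE_I2 ennreal_leI)
    show "AE x in M. (\<lambda>i. ennreal (norm (f x - s i x))) \<longlonglongrightarrow> 0"
      using ae
    proof eventually_elim
      case (elim x)
      have "(\<lambda>i. norm (f x - s i x)) \<longlonglongrightarrow> 0"
        using tendsto_norm[OF tendsto_diff[OF tendsto_const elim, of "f x"]] by simp
      from tendsto_ennrealI[OF this] show ?case by simp
    qed
  qed auto
  have bnd: "ennreal (dist (Bochner_Integration.simple_bochner_integral M (s i)) (Bochner_Integration.simple_bochner_integral M (s j)))
     \<le> (\<integral>\<^sup>+x. ennreal (norm (f x - s i x)) \<partial>M) + (\<integral>\<^sup>+x. ennreal (norm (f x - s j x)) \<partial>M)" for i j
  proof -
    have "ennreal (dist (Bochner_Integration.simple_bochner_integral M (s i)) (Bochner_Integration.simple_bochner_integral M (s j)))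
       = ennreal (norm (Bochner_Integration.simple_bochner_integral M (\<lambda>x. s i x - s j x)))"
      by (simp add: simple_bochner_integral_diff[OF s s] dist_norm)
    also have "\<dots> \<le> (\<integral>\<^sup>+x. ennreal (norm (s i x - s j x)) \<partial>M)"
      using simple_bochner_integrable_compose2[of "(-)", OF _ s s]
      by (intro norm_simple_bochner_integral_le) auto
    also have "\<dots> \<le> (\<integral>\<^sup>+x. ennreal (norm (f x - s i x)) + ennreal (norm (f x - s j x)) \<partial>M)"
    proof (intro nn_integral_mono)
      fix x
      have "norm (s i x - s j x) \<le> norm (f x - s i x) + norm (f x - s j x)"
        using norm_triangle_ineq4[of "f x - s j x" "f x - s i x"] by (simp add: algebra_simps)
      then show "ennreal (norm (s i x - s j x)) \<le> ennreal (norm (f x - s i x)) + ennreal (norm (f x - s j x))"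
        by (simp flip: ennreal_plus)
    qed
    also have "\<dots> = (\<integral>\<^sup>+x. ennreal (norm (f x - s i x)) \<partial>M) + (\<integral>\<^sup>+x. ennreal (norm (f x - s j x)) \<partial>M)"
      by (rule nn_integral_add) auto
    finally show ?thesis .
  qed
  have "Cauchy (\<lambda>i. Bochner_Integration.simple_bochner_integral M (s i))"
  proof (rule metric_CauchyI)
    fix e :: real assume e: "0 < e"
    then have "eventually (\<lambda>i. (\<integral>\<^sup>+x. ennreal (norm (f x - s i x)) \<partial>M) < ennreal (e/2)) sequentially"
      using lim by (intro order_tendstoD(2)) auto
    then obtain n where n: "\<And>i. i \<ge> n \<Longrightarrow> (\<integral>\<^sup>+x. ennreal (norm (f x - s i x)) \<partial>M) < ennreal (e/2)"
      by (auto simp: eventually_sequentially)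
    show "\<exists>n. \<forall>i\<ge>n. \<forall>j\<ge>n. dist (Bochner_Integration.simple_bochner_integral M (s i)) (Bochner_Integration.simple_bochner_integral M (s j)) < e"
    proof (intro exI allI impI)
      fix i j assume "i \<ge> n" "j \<ge> n"
      then have "ennreal (dist (Bochner_Integration.simple_bochner_integral M (s i)) (Bochner_Integration.simple_bochner_integral M (s j)))
          < ennreal (e/2) + ennreal (e/2)"
        using bnd[of i j] n[of i] n[of j] by (meson add_strict_mono le_less_trans)
      also have "\<dots> = ennreal e" using e by (simp flip: ennreal_plus)
      finally show "dist (Bochner_Integration.simple_bochner_integral M (s i)) (Bochner_Integration.simple_bochner_integral M (s j)) < e"
        using e by (simp add: ennreal_less_iff)
    qed
  qed
  then obtain I where "(\<lambda>i. Bochner_Integration.simple_bochner_integral M (s i)) \<longlonglongrightarrow> I"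
    using Cauchy_convergent convergent_def by blast
  then show ?thesis unfolding has_bochner_integral_strong_def
    using sm s lim by (intro exI[of _ I] conjI exI[of _ s]) auto
qed

lemma (in complete_measure) has_bochner_integral_strong_bochner_integral:
  fixes f :: "'a \<Rightarrow> 'c::banach"
  assumes "finite_measure M" "L1_function M f"
  shows "has_bochner_integral_strong M f (bochner_integral M f)"
  unfolding bochner_integral_def
  by (rule theI') (metis L1_function_has_bochner_integral_strong assms has_bochner_integral_strong_unique)

lemma (in complete_measure) norm_bochner_integral_diff_le:
  fixes f g :: "'a \<Rightarrow> 'c::banach"
  assumes "finite_measure M" "L1_function M f" "L1_function M g"
  shows "ennreal (norm (bochner_integral M f - bochner_integral M g)) \<le> (\<integral>\<^sup>+x. ennreal (norm (f x - g x)) \<partial>M)"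
  by (intro has_bochner_integral_strong_norm_le has_bochner_integral_strong_diff
      has_bochner_integral_strong_bochner_integral assms)

section \<open>Step functions and the spectral isometry\<close>

locale identity_resolution =
  fixes E :: "real \<Rightarrow> 'a::{real_inner, banach} \<Rightarrow> 'a"
  assumes resolution: "resolution_of_identity E"
begin

section \<open>Projections and the scalar spectral measure\<close>

lemma proj: "orthogonal_projection (E l)"
  using resolution by (simp add: resolution_of_identity_def)

lemma bounded_linear_E: "bounded_linear (E l)"
  using proj by (simp add: orthogonal_projection_def)

lemma E_add: "E l (x + y) = E l x + E l y" and E_diff: "E l (x - y) = E l x - E l y"
  and E_scaleR: "E l (c *\<^sub>R x) = c *\<^sub>R E l x" and E_zero: "E l 0 = 0"
  using bounded_linear_E[of l] by (simp_all add: linear_simps)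

lemma E_E: "E l (E m x) = E (min l m) x"
  using resolution by (simp add: resolution_of_identity_def)

lemma E_neg: "l < 0 \<Longrightarrow> E l x = 0"
  using resolution by (simp add: resolution_of_identity_def)

lemma E_at_top: "((\<lambda>m. E m x) \<longlongrightarrow> x) at_top"
  using resolution by (simp add: resolution_of_identity_def)

lemma E_inner: "E l x \<bullet> E m y = E (min l m) x \<bullet> y"
proof -
  have "E l x \<bullet> E m y = E m (E l x) \<bullet> y"
    using proj[of m] by (simp add: orthogonal_projection_def)
  then show ?thesis by (simp add: E_E min.commute)
qed

definition F :: "'a \<Rightarrow> real \<Rightarrow> real" where "F x l = (norm (E l x))\<^sup>2"

abbreviation \<mu> :: "'a \<Rightarrow> real measure" where "\<mu> x \<equiv> interval_measure (F x)"

lemma E_inner_F: "E l x \<bullet> E m x = F x (min l m)"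
proof -
  have "E l x \<bullet> E m x = E (min l m) x \<bullet> E (min l m) x"
    by (simp add: E_inner)
  then show ?thesis by (simp add: F_def power2_norm_eq_inner)
qed

lemma inner_E_self: "x \<bullet> E l x = F x l"
proof -
  have "E l x \<bullet> E l x = E l x \<bullet> x" by (simp add: E_inner)
  then show ?thesis by (simp add: F_def power2_norm_eq_inner inner_commute)
qed

text \<open>Pythagoras for the orthogonal splitting of x into \<open>E l x\<close> and the rest. It
  later also measures the distance between two truncations of a spectral integral.\<close>

lemma norm_complement: "(norm (x - E l x))\<^sup>2 = (norm x)\<^sup>2 - F x l"
  using inner_E_self[of x l]
  by (simp add: F_def power2_norm_eq_inner inner_diff_left inner_diff_right inner_commute)

lemma F_le: "F x l \<le> (norm x)\<^sup>2"
  using norm_complement[of x l] zero_le_power2[of "norm (x - E l x)"] by linarith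

lemma norm_E_le: "norm (E l x) \<le> norm x"
  using F_le[of x l] unfolding F_def by (rule power2_le_imp_le) simp

lemma norm_complement_le: "norm (x - E l x) \<le> norm x"
  by (rule power2_le_imp_le) (simp_all add: norm_complement F_def)

text \<open>Since \<open>E l x = E l (E m x)\<close>, this is contractivity of \<open>E l\<close> at
  \<open>E m x\<close>. With right continuity it makes \<open>F x\<close> a distribution
  function.\<close>

lemma F_mono: "l \<le> m \<Longrightarrow> F x l \<le> F x m"
  using F_le[of "E m x" l] by (simp add: F_def E_E min_def)

lemma F_right_continuous: "continuous (at_right l) (F x)"
  using resolution unfolding continuous_within F_def resolution_of_identity_def
  by (intro tendsto_power tendsto_norm) simp

lemma F_nonneg: "0 \<le> F x l" by (simp add: F_def)

lemma emeasure_Ioc: "emeasure (\<mu> x) {a<..b} = (if a \<le> b then ennreal (F x b - F x a) else 0)"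
  using emeasure_interval_measure_Ioc_eq[of "F x" a b, OF F_mono F_right_continuous] by simp

text \<open>The intervals (-i, i] exhaust the line, and an increment of \<open>F x\<close> never
  exceeds the value at its right end.\<close>

lemma emeasure_UNIV_le: "emeasure (\<mu> x) UNIV \<le> ennreal ((norm x)\<^sup>2)"
proof -
  have UN: "(\<Union>i::nat. {- real i<..real i}) = UNIV"
    by (auto simp: set_eq_iff) (metis abs_le_D1 abs_less_iff neg_less_iff_less minus_minus reals_Archimedean2 less_imp_le)
  have "emeasure (\<mu> x) UNIV = (SUP i::nat. emeasure (\<mu> x) {- real i<..real i})"
    by (subst SUP_emeasure_incseq) (auto simp: incseq_def UN)
  also have "\<dots> \<le> ennreal ((norm x)\<^sup>2)"
  proof (rule SUP_least)
    fix i
    have "F x (real i) - F x (- real i) \<le> (norm x)\<^sup>2"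
      using F_le[of x "real i"] F_nonneg[of x "- real i"] by linarith
    then show "emeasure (\<mu> x) {- real i<..real i} \<le> ennreal ((norm x)\<^sup>2)"
      by (simp add: emeasure_Ioc ennreal_leI)
  qed
  finally show ?thesis .
qed

lemma finite_measure_\<mu>: "finite_measure (\<mu> x)"
  using emeasure_UNIV_le[of x] by (intro finite_measureI) (auto simp: top_unique)

lemma measure_UNIV_le: "measure (\<mu> x) UNIV \<le> (norm x)\<^sup>2"
  using emeasure_UNIV_le[of x] finite_measure.emeasure_eq_measure[OF finite_measure_\<mu>]
  by (simp add: ennreal_le_iff)

lemma measure_Ioc: "measure (\<mu> x) {a<..b} = (if a \<le> b then F x b - F x a else 0)"
  by (simp add: measure_def emeasure_Ioc F_mono)

lemma integrable_bounded:
  assumes [measurable]: "g \<in> borel_measurable borel" and "\<And>l. \<bar>g l\<bar> \<le> C"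
  shows "integrable (\<mu> x) (g :: real \<Rightarrow> real)"
  by (rule finite_measure.integrable_const_bound[OF finite_measure_\<mu>, of _ C])
     (use assms in \<open>auto simp: measurable_cong_sets[OF sets_interval_measure refl]\<close>)

text \<open>\<open>step x s v\<close>: the step function \<open>s\<close> is a linear combination of indicators of half-open
  intervals, and \<open>v\<close> is the corresponding combination of increments of \<open>E x\<close>, i.e.
  \<open>v = \<integral> s dE x\<close>. The intervals need not be disjoint, so no common refinements are ever needed.\<close>

inductive step :: "'a \<Rightarrow> (real \<Rightarrow> real) \<Rightarrow> 'a \<Rightarrow> bool" for x where
  zero: "step x (\<lambda>_. 0) 0"
| add: "step x s v \<Longrightarrow> a \<le> b \<Longrightarrow>
    step x (\<lambda>l. s l + c * indicator {a<..b} l) (v + c *\<^sub>R (E b x - E a x))"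

lemma step_measurable: "step x s v \<Longrightarrow> s \<in> borel_measurable borel"
  by (induction rule: step.induct) auto

lemma step_bounded: "step x s v \<Longrightarrow> \<exists>C. \<forall>l. \<bar>s l\<bar> \<le> C"
proof (induction rule: step.induct)
  case (add s v a b c)
  then obtain C where "\<forall>l. \<bar>s l\<bar> \<le> C" by blast
  then have "\<bar>s l + c * indicator {a<..b} l\<bar> \<le> C + \<bar>c\<bar>" for l
    by (auto simp: indicator_def intro: order_trans[OF abs_triangle_ineq] add_mono add_increasing2)
  then show ?case by blast
qed auto

lemma step_single: "a \<le> b \<Longrightarrow> step x (\<lambda>l. c * indicator {a<..b} l) (c *\<^sub>R (E b x - E a x))"
  using step.add[OF step.zero] by simp

lemma step_add_scaled:
  assumes "step x s v" "step x s' v'"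
  shows "step x (\<lambda>l. s l + k * s' l) (v + k *\<^sub>R v')"
  using assms(2)
proof (induction rule: step.induct)
  case (add s' v' a b c)
  have "step x (\<lambda>l. (s l + k * s' l) + (k * c) * indicator {a<..b} l) ((v + k *\<^sub>R v') + (k * c) *\<^sub>R (E b x - E a x))"
    using add by (intro step.add)
  then show ?case by (simp add: algebra_simps)
qed (use assms(1) in simp)

lemma step_add: "step x s v \<Longrightarrow> step x s' v' \<Longrightarrow> step x (\<lambda>l. s l + s' l) (v + v')"
  using step_add_scaled[of x s v s' v' 1] by simp

lemma step_diff: "step x s v \<Longrightarrow> step x s' v' \<Longrightarrow> step x (\<lambda>l. s l - s' l) (v - v')"
  using step_add_scaled[of x s v s' v' "-1"] by simp

lemma step_sum:
  assumes "finite I" "\<And>i. i \<in> I \<Longrightarrow> step x (s i) (v i)"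
  shows "step x (\<lambda>l. \<Sum>i\<in>I. s i l) (\<Sum>i\<in>I. v i)"
  using assms by (induction I rule: finite_induct) (auto intro: step.zero step_add)

text \<open>\<open>E m\<close> clips both endpoints of an increment at m, which intersects its
  interval with {..m}; an interval lying beyond m becomes empty.\<close>

lemma step_E:
  assumes "step x s v"
  shows "step x (\<lambda>l. s l * indicator {..m} l) (E m v)"
  using assms
proof (induction rule: step.induct)
  case zero
  then show ?case by (simp add: E_zero step.zero)
next
  case (add s v a b c)
  have "step x (\<lambda>l. s l * indicator {..m} l + c * indicator {min m a<..min m b} l)
      (E m v + c *\<^sub>R (E (min m b) x - E (min m a) x))"
    using add by (intro step.add) auto
  moreover have "(s l + c * indicator {a<..b} l) * indicator {..m} l
      = s l * indicator {..m} l + c * indicator {min m a<..min m b} l" for l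
    by (auto simp: indicator_def)
  ultimately show ?case by (simp add: E_add E_diff E_scaleR E_E)
qed

lemma inner_increments:
  assumes "a \<le> b" "c \<le> d"
  shows "(E b x - E a x) \<bullet> (E d x - E c x) = measure (\<mu> x) ({a<..b} \<inter> {c<..d})"
proof -
  have "{a<..b} \<inter> {c<..d} = {max a c<..min b d}" by auto
  then show ?thesis using assms
    by (simp add: inner_diff_left inner_diff_right E_inner_F measure_Ioc) (auto simp: min_def max_def)
qed

lemma integrable_indicator_step:
  assumes "step x s v"
  shows "integrable (\<mu> x) (\<lambda>l. indicator {a<..b} l * s l)"
proof -
  obtain C where "\<forall>l. \<bar>s l\<bar> \<le> C" using step_bounded[OF assms] by blast
  moreover from this have "0 \<le> C" using abs_ge_zero order_trans by blast
  ultimately show ?thesis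
    using step_measurable[OF assms] by (intro integrable_bounded[of _ C]) (auto simp: indicator_def)
qed

lemma integrable_step2:
  assumes "step x s v"
  shows "integrable (\<mu> x) (\<lambda>l. (s l)\<^sup>2)"
proof -
  obtain C where "\<forall>l. \<bar>s l\<bar> \<le> C" using step_bounded[OF assms] by blast
  then have "\<bar>s l\<bar> \<le> \<bar>C\<bar>" for l by (meson abs_ge_self order_trans)
  then show ?thesis
    using step_measurable[OF assms] by (intro integrable_bounded[of _ "C\<^sup>2"]) (auto simp: abs_le_square_iff[symmetric])
qed

text \<open>Linear in the step function, so the induction reduces it to two increments. It supplies
  the cross term in \<open>norm_step\<close>.\<close>

lemma inner_increment_step:
  assumes "step x s v" "a \<le> b"
  shows "(E b x - E a x) \<bullet> v = (\<integral>l. indicator {a<..b} l * s l \<partial>\<mu> x)"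
  using assms
proof (induction rule: step.induct)
  case (add s v c d k)
  have eq: "indicator {a<..b} l * (s l + k * indicator {c<..d} l)
      = indicator {a<..b} l * s l + k * indicator ({a<..b} \<inter> {c<..d}) l" for l :: real
    by (auto simp: indicator_def)
  have i2: "integrable (\<mu> x) (\<lambda>l. k * indicator ({a<..b} \<inter> {c<..d}) l :: real)"
    by (intro integrable_bounded[of _ "\<bar>k\<bar>"]) (auto simp: indicator_def)
  have "(\<integral>l. indicator {a<..b} l * (s l + k * indicator {c<..d} l) \<partial>\<mu> x)
      = (\<integral>l. indicator {a<..b} l * s l \<partial>\<mu> x) + (\<integral>l. k * indicator ({a<..b} \<inter> {c<..d}) l \<partial>\<mu> x)"
    unfolding eq by (intro Bochner_Integration.integral_add integrable_indicator_step[OF add.hyps(1)] i2)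
  then show ?case using add
    by (simp add: inner_add_right inner_increments)
qed simp

text \<open>Adding a term expands the squared norm and the squared integrand in the same way, cross
  term included, so overlapping intervals are harmless. Applied to differences it shows that v
  depends only on s and not on how s is written.\<close>

lemma norm_step:
  assumes "step x s v"
  shows "(norm v)\<^sup>2 = (\<integral>l. (s l)\<^sup>2 \<partial>\<mu> x)"
  using assms
proof (induction rule: step.induct)
  case (add s v a b c)
  have eq: "(s l + c * indicator {a<..b} l)\<^sup>2
     = (s l)\<^sup>2 + (2 * c * (indicator {a<..b} l * s l) + c\<^sup>2 * (indicator {a<..b} l * indicator {a<..b} l))" for l
    by (auto simp: indicator_def power2_eq_square algebra_simps)
  have "(\<integral>l. (s l + c * indicator {a<..b} l)\<^sup>2 \<partial>\<mu> x)
      = (\<integral>l. (s l)\<^sup>2 \<partial>\<mu> x) + (2 * c * (\<integral>l. indicator {a<..b} l * s l \<partial>\<mu> x)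
        + c\<^sup>2 * (\<integral>l. indicator {a<..b} l * (1 * indicator {a<..b} l) \<partial>\<mu> x))"
    unfolding eq
    using integrable_step2[OF add.hyps(1)] integrable_indicator_step[OF add.hyps(1)]
      integrable_indicator_step[OF step_single[OF add.hyps(2), of x 1]]
    by (simp del: integral_indicator Int_absorb indicator_inter_arith add: Bochner_Integration.integral_add)
  also have "\<dots> = (norm v)\<^sup>2 + (2 * c * ((E b x - E a x) \<bullet> v) + c\<^sup>2 * ((E b x - E a x) \<bullet> (E b x - E a x)))"
    using add.IH inner_increment_step[OF add.hyps] inner_increment_step[OF step_single[OF add.hyps(2), of x 1] add.hyps(2)]
    by simp
  also have "\<dots> = (norm (v + c *\<^sub>R (E b x - E a x)))\<^sup>2"
    unfolding power2_norm_eq_inner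
    by (simp add: inner_add_left inner_add_right inner_commute power2_eq_square algebra_simps)
  finally show ?case ..
qed simp

text \<open>\<open>dE_integral x g y\<close> means \<open>y = \<integral> g dE x\<close>, where \<open>g\<close> is a bounded pointwise limit of step functions.\<close>

definition dE_integral :: "'a \<Rightarrow> (real \<Rightarrow> real) \<Rightarrow> 'a \<Rightarrow> bool" where
  "dE_integral x g y \<longleftrightarrow> (\<exists>C s v. (\<forall>n::nat. step x (s n) (v n) \<and> (\<forall>l. \<bar>s n l\<bar> \<le> C)) \<and>
      (\<forall>l. (\<lambda>n. s n l) \<longlonglongrightarrow> g l) \<and> v \<longlonglongrightarrow> y)"

lemma dE_integralE:
  assumes "dE_integral x g y"
  obtains C s v where "\<And>n::nat. step x (s n) (v n)" "\<And>n l. \<bar>s n l\<bar> \<le> C"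
    "\<And>l. (\<lambda>n. s n l) \<longlonglongrightarrow> g l" "v \<longlonglongrightarrow> y"
  using assms unfolding dE_integral_def by blast

lemma dE_integralI:
  assumes "\<And>n::nat. step x (s n) (v n)" "\<And>n l. \<bar>s n l\<bar> \<le> C"
    "\<And>l. (\<lambda>n. s n l) \<longlonglongrightarrow> g l" "v \<longlonglongrightarrow> y"
  shows "dE_integral x g y"
  using assms unfolding dE_integral_def by blast

text \<open>Limit of \<open>norm_step\<close>. The uniform bound C in \<open>dE_integral\<close>
  gives the constant majorant \<open>C\<^sup>2\<close>, integrable because the spectral measure is
  finite.\<close>

lemma dE_integral_norm:
  assumes "dE_integral x g y"
  shows "(norm y)\<^sup>2 = (\<integral>l. (g l)\<^sup>2 \<partial>\<mu> x)"
proof -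
  obtain C s v where s: "\<And>n::nat. step x (s n) (v n)" "\<And>n l. \<bar>s n l\<bar> \<le> C"
    "\<And>l. (\<lambda>n. s n l) \<longlonglongrightarrow> g l" "v \<longlonglongrightarrow> y"
    by (rule dE_integralE[OF assms]) (rule that)
  have [measurable]: "s n \<in> borel_measurable borel" for n using step_measurable[OF s(1)] .
  have [measurable]: "g \<in> borel_measurable borel"
    by (rule borel_measurable_LIMSEQ_metric[of s]) (auto intro: s(3))
  have "(\<lambda>n. \<integral>l. (s n l)\<^sup>2 \<partial>\<mu> x) \<longlonglongrightarrow> (\<integral>l. (g l)\<^sup>2 \<partial>\<mu> x)"
  proof (rule integral_dominated_convergence[where w="\<lambda>_. C\<^sup>2"])
    show "integrable (\<mu> x) (\<lambda>_. C\<^sup>2)" by (intro integrable_bounded[of _ "C\<^sup>2"]) auto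
    show "AE l in \<mu> x. (\<lambda>n. (s n l)\<^sup>2) \<longlonglongrightarrow> (g l)\<^sup>2"
      by (intro AE_I2 tendsto_power s(3))
    show "AE l in \<mu> x. norm ((s n l)\<^sup>2) \<le> C\<^sup>2" for n
      using power_mono[OF s(2) abs_ge_zero, of n _ 2] by (intro AE_I2) simp
  qed auto
  moreover have "(\<lambda>n. (norm (v n))\<^sup>2) \<longlonglongrightarrow> (norm y)\<^sup>2"
    by (intro tendsto_power tendsto_norm s)
  ultimately show ?thesis unfolding norm_step[OF s(1)] by (rule LIMSEQ_unique[symmetric])
qed

lemma dE_integral_measurable: "dE_integral x g y \<Longrightarrow> g \<in> borel_measurable borel"
  by (elim dE_integralE, rule borel_measurable_LIMSEQ_metric, rule step_measurable) auto

lemma dE_integral_add_scaled: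
  assumes "dE_integral x g y" "dE_integral x g' y'"
  shows "dE_integral x (\<lambda>l. g l + k * g' l) (y + k *\<^sub>R y')"
proof -
  obtain C s v where s: "\<And>n::nat. step x (s n) (v n)" "\<And>n l. \<bar>s n l\<bar> \<le> C"
    "\<And>l. (\<lambda>n. s n l) \<longlonglongrightarrow> g l" "v \<longlonglongrightarrow> y"
    by (rule dE_integralE[OF assms(1)]) (rule that)
  obtain C' s' v' where s': "\<And>n::nat. step x (s' n) (v' n)" "\<And>n l. \<bar>s' n l\<bar> \<le> C'"
    "\<And>l. (\<lambda>n. s' n l) \<longlonglongrightarrow> g' l" "v' \<longlonglongrightarrow> y'"
    by (rule dE_integralE[OF assms(2)]) (rule that)
  have "\<bar>s n l + k * s' n l\<bar> \<le> C + \<bar>k\<bar> * C'" for n l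
    using s(2)[of n l] mult_left_mono[OF s'(2)[of n l], of "\<bar>k\<bar>"]
      abs_triangle_ineq[of "s n l" "k * s' n l"] by (simp add: abs_mult)
  then show ?thesis
    by (intro dE_integralI[where s="\<lambda>n l. s n l + k * s' n l" and v="\<lambda>n. v n + k *\<^sub>R v' n"])
       (simp_all add: step_add_scaled s s' tendsto_intros)
qed

lemma dE_integral_add: "dE_integral x g y \<Longrightarrow> dE_integral x g' y' \<Longrightarrow> dE_integral x (\<lambda>l. g l + g' l) (y + y')"
  using dE_integral_add_scaled[of x g y g' y' 1] by simp

lemma dE_integral_diff: "dE_integral x g y \<Longrightarrow> dE_integral x g' y' \<Longrightarrow> dE_integral x (\<lambda>l. g l - g' l) (y - y')"
  using dE_integral_add_scaled[of x g y g' y' "-1"] by simp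

text \<open>The difference integrates the zero function, so its norm is 0: the value does not depend
  on the approximating step functions.\<close>

lemma dE_integral_unique: "dE_integral x g y \<Longrightarrow> dE_integral x g y' \<Longrightarrow> y = y'"
  using dE_integral_norm[OF dE_integral_diff[of x g y g y']] by simp

lemma dE_integral_E:
  assumes "dE_integral x g y"
  shows "dE_integral x (\<lambda>l. g l * indicator {..m} l) (E m y)"
proof -
  obtain C s v where s: "\<And>n::nat. step x (s n) (v n)" "\<And>n l. \<bar>s n l\<bar> \<le> C"
    "\<And>l. (\<lambda>n. s n l) \<longlonglongrightarrow> g l" "v \<longlonglongrightarrow> y"
    by (rule dE_integralE[OF assms(1)]) (rule that)
  have "\<bar>s n l * indicator {..m} l\<bar> \<le> C" for n l
    using s(2)[of n l] by (auto simp: indicator_def)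
  then show ?thesis
    by (intro dE_integralI[where s="\<lambda>n l. s n l * indicator {..m} l" and v="\<lambda>n. E m (v n)"])
       (simp_all add: step_E s tendsto_intros bounded_linear.tendsto[OF bounded_linear_E])
qed

text \<open>The point 0 is the limit of the intervals (-1/(n+1), 0]. \<open>E\<close> vanishes at
  their left ends, so every approximant already has the value on the right.\<close>

lemma dE_integral_atom: "dE_integral x (\<lambda>l. c * indicator {0} l) (c *\<^sub>R E 0 x)"
proof (rule dE_integralI[where s="\<lambda>n l. c * indicator {- inverse (real (Suc n))<..0} l" and v="\<lambda>_. c *\<^sub>R E 0 x"])
  fix n
  show "step x (\<lambda>l. c * indicator {- inverse (real (Suc n))<..0} l) (c *\<^sub>R E 0 x)"
    using step_single[of "- inverse (real (Suc n))" 0 x c] E_neg[of "- inverse (real (Suc n))" x] by simp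
  show "\<bar>c * indicator {- inverse (real (Suc n))<..0} l\<bar> \<le> \<bar>c\<bar>" for l :: real
    by (simp add: indicator_def)
next
  fix l :: real
  show "(\<lambda>n. c * indicator {- inverse (real (Suc n))<..0} l) \<longlonglongrightarrow> c * indicator {0} l"
  proof (cases "l < 0")
    case True
    have "(\<lambda>n. - inverse (real (Suc n))) \<longlonglongrightarrow> - 0"
      by (intro tendsto_minus LIMSEQ_inverse_real_of_nat)
    then have "eventually (\<lambda>n. - inverse (real (Suc n)) > l) sequentially"
      using True by (intro order_tendstoD(1)) auto
    then have "eventually (\<lambda>n. c * indicator {- inverse (real (Suc n))<..0} l = c * indicator {0} l) sequentially"
      by eventually_elim (use True in auto)
    then show ?thesis by (rule tendsto_eventually)
  qed (auto simp: indicator_def)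
qed simp

end

section \<open>Spectral integrals of continuous functions\<close>

text \<open>Cousin's lemma gives a division fine for both meshes; its sum would lie within half the
  distance of both candidate values.\<close>

lemma has_RS_integral_unique:
  assumes I: "has_RS_integral g F a b I" and J: "has_RS_integral g F a b J"
  shows "I = J"
proof (rule ccontr)
  assume "I \<noteq> J"
  then have e: "norm (I - J) / 2 > 0" by simp
  let ?S = "\<lambda>p. \<Sum>(x, K)\<in>p. g x *\<^sub>R (F (Sup K) - F (Inf K))"
  obtain d1 where d1: "d1 > 0" "\<And>p. p tagged_division_of {a..b} \<Longrightarrow> (\<lambda>x. ball x d1) fine p \<Longrightarrow> norm (?S p - I) < norm (I - J) / 2"
    using I[unfolded has_RS_integral_def, rule_format, OF e] by blast
  obtain d2 where d2: "d2 > 0" "\<And>p. p tagged_division_of {a..b} \<Longrightarrow> (\<lambda>x. ball x d2) fine p \<Longrightarrow> norm (?S p - J) < norm (I - J) / 2"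
    using J[unfolded has_RS_integral_def, rule_format, OF e] by blast
  have "gauge (\<lambda>x. ball x (min d1 d2))" using d1(1) d2(1) by (auto simp: gauge_def)
  then obtain p where p: "p tagged_division_of {a..b}" "(\<lambda>x. ball x (min d1 d2)) fine p"
    by (rule fine_division_exists_real)
  have "(\<lambda>x. ball x d1) fine p" "(\<lambda>x. ball x d2) fine p"
    using p(2) by (force simp: fine_def)+
  from d1(2)[OF p(1) this(1)] d2(2)[OF p(1) this(2)]
  have "norm (?S p - I) < norm (I - J) / 2" "norm (?S p - J) < norm (I - J) / 2" .
  then show False
    using norm_triangle_ineq4[of "?S p - J" "?S p - I"] by simp
qed

lemma RS_integral_eq: "has_RS_integral g F a b I \<Longrightarrow> RS_integral g F a b = I"
  unfolding RS_integral_def by (rule the_equality) (auto intro: has_RS_integral_unique)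

lemma has_RS_integral_diff:
  assumes I: "has_RS_integral g F a b I" and J: "has_RS_integral g G a b J"
  shows "has_RS_integral g (\<lambda>l. F l - G l) a b (I - J)"
  unfolding has_RS_integral_def
proof (intro allI impI)
  fix e :: real assume "0 < e"
  then have e: "e / 2 > 0" by simp
  let ?S = "\<lambda>F p. \<Sum>(x, K)\<in>p. g x *\<^sub>R (F (Sup K) - F (Inf K))"
  obtain d1 where d1: "d1 > 0" "\<And>p. p tagged_division_of {a..b} \<Longrightarrow> (\<lambda>x. ball x d1) fine p \<Longrightarrow> norm (?S F p - I) < e / 2"
    using I[unfolded has_RS_integral_def, rule_format, OF e] by blast
  obtain d2 where d2: "d2 > 0" "\<And>p. p tagged_division_of {a..b} \<Longrightarrow> (\<lambda>x. ball x d2) fine p \<Longrightarrow> norm (?S G p - J) < e / 2"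
    using J[unfolded has_RS_integral_def, rule_format, OF e] by blast
  show "\<exists>d>0. \<forall>p. p tagged_division_of {a..b} \<and> (\<lambda>x. ball x d) fine p \<longrightarrow>
      norm (?S (\<lambda>l. F l - G l) p - (I - J)) < e"
  proof (intro exI[of _ "min d1 d2"] conjI allI impI)
    fix p assume p: "p tagged_division_of {a..b} \<and> (\<lambda>x. ball x (min d1 d2)) fine p"
    have "(\<lambda>x. ball x d1) fine p" "(\<lambda>x. ball x d2) fine p"
      using p by (force simp: fine_def)+
    from d1(2)[OF conjunct1[OF p] this(1)] d2(2)[OF conjunct1[OF p] this(2)]
    have "norm (?S F p - I) < e / 2" "norm (?S G p - J) < e / 2" .
    then have "norm ((?S F p - I) - (?S G p - J)) < e"
      using norm_triangle_ineq4[of "?S F p - I" "?S G p - J"] by linarith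
    moreover have "?S (\<lambda>l. F l - G l) p = ?S F p - ?S G p"
      unfolding sum_subtractf[symmetric] by (intro sum.cong) (auto simp: algebra_simps)
    moreover have "u - v - (I - J) = (u - I) - (v - J)" for u v by simp
    ultimately show "norm (?S (\<lambda>l. F l - G l) p - (I - J)) < e" by (simp only:)
  qed (use d1(1) d2(1) in simp)
qed

lemma tagged_division_interval:
  fixes a b :: real
  assumes "p tagged_division_of {a..b}" "(x, K) \<in> p"
  shows "Inf K \<le> Sup K" "{Inf K<..Sup K} \<subseteq> K" "x \<in> K" "K \<subseteq> {a..b}"
proof -
  obtain c d where K: "K = cbox c d" using tagged_division_ofD(4)[OF assms] by blast
  show x: "x \<in> K" using tagged_division_ofD(2)[OF assms] .
  show "K \<subseteq> {a..b}" using tagged_division_ofD(3)[OF assms] .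
  from x K have "c \<le> d" by auto
  then show "Inf K \<le> Sup K" "{Inf K<..Sup K} \<subseteq> K" by (auto simp: K)
qed

text \<open>Half-open pieces share no endpoints, so the identity is exact at every l. An almost
  everywhere version for Lebesgue measure would not do, since the spectral measure may have
  atoms.\<close>

lemma tagged_division_indicator_sum:
  fixes a b :: real
  assumes "p tagged_division_of {a..b}" "a \<le> b"
  shows "(\<Sum>(x, K)\<in>p. indicator {Inf K<..Sup K} l) = (indicator {a<..b} l :: real)"
proof -
  \<comment> \<open>telescope the jump function at \<open>l\<close> along the division\<close>
  have "(\<Sum>(x, K)\<in>p. indicator {Inf K<..Sup K} l)
      = (\<Sum>(x, K)\<in>p. indicator {l..} (Sup K) - indicator {l..} (Inf K) :: real)"
  proof (rule sum.cong[OF refl], safe)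
    fix x K assume "(x, K) \<in> p"
    from tagged_division_interval(1)[OF assms(1) this]
    show "indicator {Inf K<..Sup K} l = (indicator {l..} (Sup K) - indicator {l..} (Inf K) :: real)"
      by (auto simp: indicator_def)
  qed
  also have "\<dots> = indicator {l..} b - indicator {l..} a"
    by (rule additive_tagged_division_1[OF assms(2,1)])
  also have "\<dots> = indicator {a<..b} l"
    using assms(2) by (auto simp: indicator_def)
  finally show ?thesis .
qed

section \<open>Riemann-Stieltjes integrals against \<open>E\<close> and truncated spectral
  integrals\<close>

context identity_resolution
begin

text \<open>The isometry and the total mass bound turn uniform closeness of step functions into
  closeness of vectors.\<close>

lemma norm_step_le:
  assumes "step x s v" "\<And>l. \<bar>s l\<bar> \<le> C"
  shows "norm v \<le> C * norm x"
proof -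
  have C: "0 \<le> C" using assms(2)[of 0] by linarith
  have sq: "(s l)\<^sup>2 \<le> C\<^sup>2" for l using power_mono[OF assms(2) abs_ge_zero, of l 2] by simp
  have "(norm v)\<^sup>2 = (\<integral>l. (s l)\<^sup>2 \<partial>\<mu> x)" by (rule norm_step[OF assms(1)])
  also have "\<dots> \<le> (\<integral>l. C\<^sup>2 \<partial>\<mu> x)"
    by (intro integral_mono integrable_step2[OF assms(1)] integrable_bounded[of _ "C\<^sup>2"] sq) auto
  also have "\<dots> \<le> C\<^sup>2 * (norm x)\<^sup>2"
    using mult_left_mono[OF measure_UNIV_le[of x], of "C\<^sup>2"] by (simp add: mult.commute)
  also have "\<dots> = (C * norm x)\<^sup>2" by (simp add: power_mult_distrib)
  finally show ?thesis by (rule power2_le_imp_le) (use C in simp)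
qed

text \<open>Every Riemann-Stieltjes sum is the integral of a step function, which puts such sums
  under the control of the isometry.\<close>

lemma tagged_sum_step:
  fixes g :: "real \<Rightarrow> real"
  assumes p: "p tagged_division_of {a..b}"
  shows "step x (\<lambda>l. \<Sum>(t, K)\<in>p. g t * indicator {Inf K<..Sup K} l)
     (\<Sum>(t, K)\<in>p. g t *\<^sub>R (E (Sup K) x - E (Inf K) x))"
  unfolding split_beta
proof (rule step_sum)
  show "step x (\<lambda>l. g (fst i) * indicator {Inf (snd i)<..Sup (snd i)} l)
      (g (fst i) *\<^sub>R (E (Sup (snd i)) x - E (Inf (snd i)) x))" if "i \<in> p" for i
    using tagged_division_interval(1)[OF p, of "fst i" "snd i"] that by (intro step_single) simp
qed (rule tagged_division_ofD(1)[OF p])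

text \<open>If l lies in the piece K with tag t, fineness puts K inside \<open>ball t d\<close>, so
  g t and g l differ by at most e. The other pieces contribute nothing at l.\<close>

lemma tagged_sum_close:
  fixes g :: "real \<Rightarrow> real"
  assumes p: "p tagged_division_of {a..b}" and "a \<le> b" and fine: "(\<lambda>x. ball x d) fine p"
    and g: "\<And>u w. u \<in> {a..b} \<Longrightarrow> w \<in> {a..b} \<Longrightarrow> dist u w < d \<Longrightarrow> \<bar>g u - g w\<bar> \<le> e"
    and "0 \<le> e"
  shows "\<bar>(\<Sum>(t, K)\<in>p. g t * indicator {Inf K<..Sup K} l) - g l * indicator {a<..b} l\<bar> \<le> e"
proof -
  let ?i = "\<lambda>K. indicator {Inf K<..Sup K} l :: real"
  have bound: "\<bar>(g t - g l) * ?i K\<bar> \<le> e * ?i K" if "(t, K) \<in> p" for t K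
  proof (cases "l \<in> {Inf K<..Sup K}")
    case True
    note K = tagged_division_interval[OF p that]
    have "K \<subseteq> ball t d" using fine that by (auto simp: fine_def)
    then have "\<bar>g t - g l\<bar> \<le> e" using K True by (intro g) (auto simp: subset_eq)
    then show ?thesis using True by simp
  qed simp
  have "(\<Sum>(t, K)\<in>p. g t * ?i K) - g l * indicator {a<..b} l = (\<Sum>(t, K)\<in>p. (g t - g l) * ?i K)"
    unfolding tagged_division_indicator_sum[OF p \<open>a \<le> b\<close>, symmetric] sum_distrib_left sum_subtractf[symmetric]
    by (intro sum.cong) (auto simp: algebra_simps)
  also have "\<bar>\<dots>\<bar> \<le> (\<Sum>(t, K)\<in>p. e * ?i K)"
    by (rule order_trans[OF sum_abs], rule sum_mono) (use bound in auto)
  also have "\<dots> = e * indicator {a<..b} l"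
    unfolding tagged_division_indicator_sum[OF p \<open>a \<le> b\<close>, symmetric] sum_distrib_left
    by (intro sum.cong) auto
  also have "\<dots> \<le> e" using \<open>0 \<le> e\<close> by (simp add: indicator_def)
  finally show ?thesis .
qed

text \<open>Uniform continuity of g gives a constant mesh, as \<open>has_RS_integral\<close>
  demands. One sequence of ever finer divisions serves both claims, which identifies the
  Riemann-Stieltjes value with the isometric integral over (0,b].\<close>

lemma RS_integral_exists:
  fixes g :: "real \<Rightarrow> real"
  assumes b: "0 \<le> b" and g: "continuous_on {0..b} g"
  shows "\<exists>I. has_RS_integral g (\<lambda>l. E l x) 0 b I \<and> dE_integral x (\<lambda>l. g l * indicator {0<..b} l) I"
proof -
  let ?S = "\<lambda>p. \<Sum>(t, K)\<in>p. g t *\<^sub>R (E (Sup K) x - E (Inf K) x)"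
  let ?s = "\<lambda>p l. \<Sum>(t, K)\<in>p. g t * indicator {Inf K<..Sup K} l"
  let ?g = "\<lambda>l. g l * indicator {0<..b} l"
  have uc: "uniformly_continuous_on {0..b} g"
    using g by (intro compact_uniformly_continuous) auto
  define near where "near n p \<longleftrightarrow> (\<forall>l. \<bar>?s p l - ?g l\<bar> \<le> inverse (real (Suc n)))" for n p
  have "\<exists>d>0. \<forall>p. p tagged_division_of {0..b} \<longrightarrow> (\<lambda>x. ball x d) fine p \<longrightarrow> near n p" for n
  proof -
    have e: "inverse (real (Suc n)) > 0" by simp
    obtain d where d: "d > 0" "\<And>u w. u \<in> {0..b} \<Longrightarrow> w \<in> {0..b} \<Longrightarrow> dist w u < d \<Longrightarrow> dist (g w) (g u) < inverse (real (Suc n))"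
      using uniformly_continuous_onE[OF uc e] by metis
    have g': "\<bar>g u - g w\<bar> \<le> inverse (real (Suc n))" if "u \<in> {0..b}" "w \<in> {0..b}" "dist u w < d" for u w
      using d(2)[OF that(2,1,3)] by (simp add: dist_real_def)
    have "near n p" if "p tagged_division_of {0..b}" "(\<lambda>x. ball x d) fine p" for p
      unfolding near_def by (intro allI tagged_sum_close[OF that(1) b that(2) _ less_imp_le[OF e]] g')
    with d(1) show ?thesis by blast
  qed
  from choice[OF allI[OF this]] obtain d where "\<forall>n. d n > 0 \<and> (\<forall>p. p tagged_division_of {0..b} \<longrightarrow>
      (\<lambda>x. ball x (d n)) fine p \<longrightarrow> near n p)" ..
  then have d: "d n > 0" and "p tagged_division_of {0..b} \<Longrightarrow>
      (\<lambda>x. ball x (d n)) fine p \<Longrightarrow> near n p" for n p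
    by blast+
  then have close: "p tagged_division_of {0..b} \<Longrightarrow> (\<lambda>x. ball x (d n)) fine p \<Longrightarrow>
      \<bar>?s p l - ?g l\<bar> \<le> inverse (real (Suc n))" for n p l
    unfolding near_def by iprover
  have "\<exists>p. p tagged_division_of {0..b} \<and> (\<lambda>x. ball x (d n)) fine p" for n
  proof -
    have "gauge (\<lambda>x::real. ball x (d n))" using d[of n] by (auto simp: gauge_def)
    then show ?thesis by (rule fine_division_exists_real) blast
  qed
  from choice[OF allI[OF this]] obtain p
    where "\<forall>n. p n tagged_division_of {0..b} \<and> (\<lambda>x. ball x (d n)) fine p n" ..
  then have p: "p n tagged_division_of {0..b}" and fine: "(\<lambda>x. ball x (d n)) fine p n" for n
    by blast+
  \<comment> \<open>Comparing an arbitrary fine q, and not just p n, with p m yields both the Cauchy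
    property and convergence along all fine divisions.\<close>
  have diff: "norm (?S q - ?S (p m)) \<le> (inverse (real (Suc n)) + inverse (real (Suc m))) * norm x"
    if q: "q tagged_division_of {0..b}" "(\<lambda>x. ball x (d n)) fine q" for q n m
  proof (rule norm_step_le)
    show "step x (\<lambda>l. ?s q l - ?s (p m) l) (?S q - ?S (p m))"
      by (rule step_diff[OF tagged_sum_step[OF q(1)] tagged_sum_step[OF p]])
    show "\<bar>?s q l - ?s (p m) l\<bar> \<le> inverse (real (Suc n)) + inverse (real (Suc m))" for l
      using close[OF q, of l] close[OF p[of m] fine[of m], of l] by linarith
  qed
  have small: "\<exists>N. \<forall>n\<ge>N. inverse (real (Suc n)) * norm x < e" if "e > 0" for e
  proof -
    have "(\<lambda>n. inverse (real (Suc n)) * norm x) \<longlonglongrightarrow> 0 * norm x"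
      by (intro tendsto_mult LIMSEQ_inverse_real_of_nat tendsto_const)
    from order_tendstoD(2)[OF this, of e] that show ?thesis
      by (simp only: eventually_sequentially mult_zero_left simp_thms)
  qed
  have "Cauchy (\<lambda>n. ?S (p n))"
  proof (rule metric_CauchyI)
    fix e :: real assume "0 < e"
    then obtain N where N: "\<And>n. n \<ge> N \<Longrightarrow> inverse (real (Suc n)) * norm x < e / 2"
      using small[of "e/2"] by auto
    show "\<exists>N. \<forall>m\<ge>N. \<forall>n\<ge>N. dist (?S (p m)) (?S (p n)) < e"
    proof (intro exI allI impI)
      fix m n assume mn: "m \<ge> N" "n \<ge> N"
      have "dist (?S (p m)) (?S (p n)) \<le> inverse (real (Suc m)) * norm x + inverse (real (Suc n)) * norm x"
        using diff[OF p fine, of m n] unfolding dist_norm distrib_right .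
      then show "dist (?S (p m)) (?S (p n)) < e"
        using N[OF mn(1)] N[OF mn(2)] by linarith
    qed
  qed
  then obtain I where I: "(\<lambda>n. ?S (p n)) \<longlonglongrightarrow> I"
    using Cauchy_convergent convergent_def by blast
  have "has_RS_integral g (\<lambda>l. E l x) 0 b I"
    unfolding has_RS_integral_def
  proof (intro allI impI)
    fix e :: real assume "0 < e"
    then obtain n where n: "inverse (real (Suc n)) * norm x < e / 2"
      using small[of "e/2"] by auto
    show "\<exists>d>0. \<forall>q. q tagged_division_of {0..b} \<and> (\<lambda>x. ball x d) fine q \<longrightarrow> norm (?S q - I) < e"
    proof (intro exI[of _ "d n"] conjI d allI impI)
      fix q assume q: "q tagged_division_of {0..b} \<and> (\<lambda>x. ball x (d n)) fine q"
      \<comment> \<open>Here m tends to infinity in \<open>diff\<close>; the summand 0 is the limit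
        of the error of p m.\<close>
      have "norm (?S q - I) \<le> (inverse (real (Suc n)) + 0) * norm x"
      proof (rule LIMSEQ_le)
        show "(\<lambda>m. norm (?S q - ?S (p m))) \<longlonglongrightarrow> norm (?S q - I)"
          by (intro tendsto_intros I)
        show "(\<lambda>m. (inverse (real (Suc n)) + inverse (real (Suc m))) * norm x) \<longlonglongrightarrow> (inverse (real (Suc n)) + 0) * norm x"
          by (intro tendsto_mult tendsto_add tendsto_const LIMSEQ_inverse_real_of_nat)
      qed (use diff q in blast)
      then show "norm (?S q - I) < e" using n \<open>0 < e\<close> by simp
    qed
  qed
  moreover
  obtain B where B: "\<forall>y\<in>g ` {0..b}. norm y \<le> B"
    using compact_imp_bounded[OF compact_continuous_image[OF g compact_Icc]] unfolding bounded_iff ..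
  have gB: "\<bar>?g l\<bar> \<le> \<bar>B\<bar>" for l
    using B by (cases "l \<in> {0<..b}") (fastforce intro: order_trans[OF _ abs_ge_self])+
  have "dE_integral x ?g I"
  proof (rule dE_integralI[where s="\<lambda>n. ?s (p n)" and v="\<lambda>n. ?S (p n)", OF tagged_sum_step[OF p] _ _ I])
    fix n l
    have "inverse (real (Suc n)) \<le> 1" by (simp add: field_simps)
    then show "\<bar>?s (p n) l\<bar> \<le> \<bar>B\<bar> + 1"
      using close[OF p[of n] fine[of n], of l] gB[of l] by linarith
  next
    fix l
    have "(\<lambda>n. ?s (p n) l - ?g l) \<longlonglongrightarrow> 0"
      by (rule Lim_null_comparison[OF always_eventually LIMSEQ_inverse_real_of_nat])
         (unfold real_norm_def, intro allI close p fine)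
    then show "(\<lambda>n. ?s (p n) l) \<longlonglongrightarrow> ?g l" by (rule LIM_zero_cancel)
  qed
  ultimately show ?thesis by blast
qed

lemma dE_integral_upto:
  fixes g :: "real \<Rightarrow> real"
  assumes "0 \<le> b" "continuous_on {0..} g"
  shows "dE_integral x (\<lambda>l. g l * indicator {0..b} l) (spectral_integral_upto E g b x)"
proof -
  have "continuous_on {0..b} g" using assms(2) by (rule continuous_on_subset) auto
  from RS_integral_exists[OF assms(1) this, of x]
  have "dE_integral x (\<lambda>l. g l * indicator {0<..b} l) (RS_integral g (\<lambda>l. E l x) 0 b)"
    using RS_integral_eq by metis
  from dE_integral_add[OF dE_integral_atom[of x "g 0"] this]
  have "dE_integral x (\<lambda>l. g 0 * indicator {0} l + g l * indicator {0<..b} l) (spectral_integral_upto E g b x)"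
    by (simp add: spectral_integral_upto_def)
  moreover have "g 0 * indicator {0} l + g l * indicator {0<..b} l = g l * indicator {0..b} l" for l
    using assms(1) by (auto simp: indicator_def)
  ultimately show ?thesis by simp
qed

text \<open>\<open>dE_integral x\<close> fixes the vector, so linearity in the vector is taken from
  linearity of Riemann-Stieltjes sums in the integrator.\<close>

lemma upto_diff:
  fixes g :: "real \<Rightarrow> real"
  assumes "0 \<le> b" "continuous_on {0..} g"
  shows "spectral_integral_upto E g b (x - y) = spectral_integral_upto E g b x - spectral_integral_upto E g b y"
proof -
  have "continuous_on {0..b} g" using assms(2) by (rule continuous_on_subset) auto
  from RS_integral_exists[OF assms(1) this]
  obtain I J where I: "has_RS_integral g (\<lambda>l. E l x) 0 b I" and J: "has_RS_integral g (\<lambda>l. E l y) 0 b J"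
    by metis
  have "has_RS_integral g (\<lambda>l. E l (x - y)) 0 b (I - J)"
    using has_RS_integral_diff[OF I J] by (simp add: E_diff)
  then show ?thesis using I J
    by (simp add: spectral_integral_upto_def RS_integral_eq E_diff algebra_simps)
qed

text \<open>Applying \<open>E c\<close> multiplies the integrand by the indicator of {..c};
  uniqueness of the integral does the rest.\<close>

lemma E_upto:
  fixes g :: "real \<Rightarrow> real"
  assumes "0 \<le> b" "0 \<le> c" "continuous_on {0..} g"
  shows "E c (spectral_integral_upto E g b x) = spectral_integral_upto E g (min b c) x"
proof (rule dE_integral_unique)
  have "g l * indicator {0..b} l * indicator {..c} l = g l * indicator {0..min b c} l" for l
    by (auto simp: indicator_def)
  then show "dE_integral x (\<lambda>l. g l * indicator {0..min b c} l) (E c (spectral_integral_upto E g b x))"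
    using dE_integral_E[OF dE_integral_upto[OF assms(1,3)], of x c] by (simp only:)
qed (use assms in \<open>auto intro: dE_integral_upto\<close>)

lemma norm_dE_integral_le:
  assumes s: "dE_integral x g y" and le: "\<And>l. \<bar>g l\<bar> \<le> \<bar>w l\<bar>" and w: "w \<in> borel_measurable borel" "\<And>l. \<bar>w l\<bar> \<le> C"
  shows "(norm y)\<^sup>2 \<le> (\<integral>l. (w l)\<^sup>2 \<partial>\<mu> x)"
proof -
  have wC: "(w l)\<^sup>2 \<le> C\<^sup>2" for l using power_mono[OF w(2) abs_ge_zero, of l 2] by simp
  have gw: "(g l)\<^sup>2 \<le> (w l)\<^sup>2" for l using le[of l] by (simp add: abs_le_square_iff)
  show ?thesis unfolding dE_integral_norm[OF s]
    by (intro integral_mono gw integrable_bounded[of _ "C\<^sup>2"] borel_measurable_power w dE_integral_measurable[OF s])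
       (use wC order_trans[OF gw wC] in auto)
qed

lemma norm_upto_le:
  fixes g :: "real \<Rightarrow> real"
  assumes "0 \<le> b" "continuous_on {0..} g" and C: "\<And>l. 0 \<le> l \<Longrightarrow> l \<le> b \<Longrightarrow> \<bar>g l\<bar> \<le> C"
  shows "norm (spectral_integral_upto E g b x) \<le> C * norm x"
proof -
  have C0: "0 \<le> C" using C[of 0] assms(1) by linarith
  have "(norm (spectral_integral_upto E g b x))\<^sup>2 \<le> (\<integral>l. C\<^sup>2 \<partial>\<mu> x)"
    by (rule norm_dE_integral_le[OF dE_integral_upto[OF assms(1,2)], of _ C]) (use C C0 in \<open>auto simp: indicator_def\<close>)
  also have "\<dots> \<le> C\<^sup>2 * (norm x)\<^sup>2"
    using mult_left_mono[OF measure_UNIV_le[of x], of "C\<^sup>2"] by (simp add: mult.commute)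
  also have "\<dots> = (C * norm x)\<^sup>2" by (simp add: power_mult_distrib)
  finally show ?thesis by (rule power2_le_imp_le) (use C0 in simp)
qed

lemma norm_upto_domain:
  fixes g :: "real \<Rightarrow> real"
  assumes "x \<in> spectral_domain E g" "continuous_on {0..} g"
  shows "\<exists>B. \<forall>b\<ge>0. (norm (spectral_integral_upto E g b x))\<^sup>2 \<le> B"
proof -
  let ?N = "\<integral>\<^sup>+l\<in>{0..}. ennreal (\<bar>g l\<bar>\<^sup>2) \<partial>\<mu> x"
  have fin: "?N < \<infinity>"
    using assms(1) unfolding spectral_domain_def F_def[abs_def] by simp
  have "(norm (spectral_integral_upto E g b x))\<^sup>2 \<le> enn2real ?N" if "0 \<le> b" for b
  proof -
    note s = dE_integral_upto[OF that assms(2), of x]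
    \<comment> \<open>The case distinction replaces a check of integrability: a nonintegrable
      function has integral 0 by default.\<close>
    have "ennreal ((norm (spectral_integral_upto E g b x))\<^sup>2) \<le> (\<integral>\<^sup>+l. ennreal ((g l * indicator {0..b} l)\<^sup>2) \<partial>\<mu> x)"
    proof (cases "integrable (\<mu> x) (\<lambda>l. (g l * indicator {0..b} l)\<^sup>2)")
      case True
      then show ?thesis unfolding dE_integral_norm[OF s] by (subst nn_integral_eq_integral) auto
    qed (simp add: dE_integral_norm[OF s] not_integrable_integral_eq)
    also have "\<dots> \<le> ?N"
      by (intro nn_integral_mono) (auto simp: indicator_def)
    finally show ?thesis using fin by (metis enn2real_mono enn2real_ennreal zero_le_power2 infinity_ennreal_def)
  qed
  then show ?thesis by blast
qed

lemma E_eqI: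
  assumes "\<And>b. b > 0 \<Longrightarrow> E b x = E b y"
  shows "x = y"
proof (rule tendsto_unique[OF _ _ E_at_top])
  show "((\<lambda>b. E b y) \<longlongrightarrow> x) at_top"
    by (rule Lim_transform_eventually[OF E_at_top])
       (use assms in \<open>auto intro: eventually_mono[OF eventually_gt_at_top[of 0]]\<close>)
qed simp

text \<open>Removes the cutoff b from an estimate; \<open>E_eqI\<close> does the same for
  equations.\<close>

lemma norm_le_E:
  assumes "\<And>b. b > 0 \<Longrightarrow> norm (E b x) \<le> C"
  shows "norm x \<le> C"
  by (rule tendsto_upperbound[OF tendsto_norm[OF E_at_top]])
     (use assms in \<open>auto intro: eventually_mono[OF eventually_gt_at_top[of 0]]\<close>)

text \<open>The truncations are Cauchy because \<open>E b\<close> maps a later truncation to an earlier one, so the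
  squared distance of two truncations is the difference of their squared norms.\<close>

lemma E_spectral_integral:
  fixes g :: "real \<Rightarrow> real"
  assumes x: "x \<in> spectral_domain E g" and g: "continuous_on {0..} g" and "0 \<le> b"
  shows "E b (spectral_integral E g x) = spectral_integral_upto E g b x"
proof -
  let ?T = "\<lambda>b. spectral_integral_upto E g b x"
  define a where "a n = (norm (?T (real n)))\<^sup>2" for n
  have pyth: "(norm (?T (real n) - ?T (real m)))\<^sup>2 = a n - a m" if "m \<le> n" for m n
    using norm_complement[of "?T (real n)" "real m"] E_upto[of "real n" "real m" g x] g that
    by (simp add: a_def F_def min_absorb2)
  obtain B where B: "\<forall>b\<ge>0. (norm (?T b))\<^sup>2 \<le> B" using norm_upto_domain[OF x g] by blast
  have inc: "incseq a"
    unfolding incseq_def using pyth by (metis diff_ge_0_iff_ge zero_le_power2)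
  have "convergent a"
    using inc B by (intro Bseq_mono_convergent BseqI'[of _ B]) (auto simp: incseq_def a_def)
  then have "Cauchy a" by (rule convergent_Cauchy)
  have "Cauchy (\<lambda>n. ?T (real n))"
  proof (rule metric_CauchyI)
    fix e :: real assume e: "0 < e"
    then obtain N where N: "\<And>m n. m \<ge> N \<Longrightarrow> n \<ge> N \<Longrightarrow> dist (a m) (a n) < e\<^sup>2"
      using metric_CauchyD[OF \<open>Cauchy a\<close>, of "e\<^sup>2"] by auto
    have *: "dist (?T (real m)) (?T (real n)) < e" if "m \<ge> N" "n \<ge> N" "m \<le> n" for m n
    proof -
      have "(dist (?T (real m)) (?T (real n)))\<^sup>2 < e\<^sup>2"
        using pyth[OF that(3)] N[OF that(1,2)] by (simp add: dist_norm norm_minus_commute)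
      then show ?thesis using e by (simp add: power2_less_imp_less)
    qed
    show "\<exists>N. \<forall>m\<ge>N. \<forall>n\<ge>N. dist (?T (real m)) (?T (real n)) < e"
      using * by (metis dist_commute linear)
  qed
  then obtain y where y: "(\<lambda>n. ?T (real n)) \<longlonglongrightarrow> y"
    using Cauchy_convergent convergent_def by blast
  have Ey: "E c y = ?T c" if "0 \<le> c" for c
  proof (rule LIMSEQ_unique)
    show "(\<lambda>n. E c (?T (real n))) \<longlonglongrightarrow> E c y"
      by (rule bounded_linear.tendsto[OF bounded_linear_E y])
    have "eventually (\<lambda>n. c \<le> real n) sequentially"
      using filterlim_real_sequentially by (simp add: filterlim_at_top)
    then have "eventually (\<lambda>n. E c (?T (real n)) = ?T c) sequentially"
      by eventually_elim (use that g in \<open>simp add: E_upto min_def\<close>)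
    then show "(\<lambda>n. E c (?T (real n))) \<longlonglongrightarrow> ?T c" by (rule tendsto_eventually)
  qed
  \<comment> \<open>So far the limit is along integers. As the truncation at any real c is
    \<open>E c y\<close>, it converges to y along the reals, which \<open>Lim at_top\<close> asks
    for.\<close>
  have "(?T \<longlongrightarrow> y) at_top"
    by (rule Lim_transform_eventually[OF E_at_top])
       (use Ey in \<open>auto intro: eventually_mono[OF eventually_ge_at_top[of 0]]\<close>)
  then have "spectral_integral E g x = y"
    unfolding spectral_integral_def by (intro tendsto_Lim) auto
  then show ?thesis using Ey[OF \<open>0 \<le> b\<close>] by simp
qed

section \<open>Membership in spectral domains, and the operators exp(rA)\<close>

lemma bounded_spectral_domain:
  fixes g :: "real \<Rightarrow> real"
  assumes "\<And>l. 0 \<le> l \<Longrightarrow> \<bar>g l\<bar> \<le> C"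
  shows "x \<in> spectral_domain E g"
proof -
  have "(\<integral>\<^sup>+l\<in>{0..}. ennreal (\<bar>g l\<bar>\<^sup>2) \<partial>\<mu> x) \<le> (\<integral>\<^sup>+l. ennreal (C\<^sup>2) \<partial>\<mu> x)"
  proof (intro nn_integral_mono)
    fix l
    show "ennreal (\<bar>g l\<bar>\<^sup>2) * indicator {0..} l \<le> ennreal (C\<^sup>2)"
      using power_mono[OF assms[of l] abs_ge_zero, of 2] by (cases "0 \<le> l") (auto intro: ennreal_leI)
  qed
  also have "\<dots> \<le> ennreal (C\<^sup>2) * ennreal ((norm x)\<^sup>2)"
    using mult_left_mono[OF emeasure_UNIV_le[of x], of "ennreal (C\<^sup>2)"] by simp
  also have "\<dots> < \<infinity>" by (simp add: ennreal_mult_less_top)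
  finally show ?thesis unfolding spectral_domain_def F_def[abs_def] by simp
qed

lemma spectral_domain_mono:
  fixes g k :: "real \<Rightarrow> real"
  assumes "x \<in> spectral_domain E g" "\<And>l. 0 \<le> l \<Longrightarrow> \<bar>k l\<bar> \<le> \<bar>g l\<bar>"
  shows "x \<in> spectral_domain E k"
proof -
  have "(\<integral>\<^sup>+l\<in>{0..}. ennreal (\<bar>k l\<bar>\<^sup>2) \<partial>\<mu> x) \<le> (\<integral>\<^sup>+l\<in>{0..}. ennreal (\<bar>g l\<bar>\<^sup>2) \<partial>\<mu> x)"
  proof (intro nn_integral_mono)
    fix l
    show "ennreal (\<bar>k l\<bar>\<^sup>2) * indicator {0..} l \<le> ennreal (\<bar>g l\<bar>\<^sup>2) * indicator {0..} l"
      using power_mono[OF assms(2)[of l] abs_ge_zero, of 2] by (cases "0 \<le> l") (auto intro: ennreal_leI)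
  qed
  also have "\<dots> < \<infinity>" using assms(1) unfolding spectral_domain_def F_def[abs_def] by simp
  finally show ?thesis unfolding spectral_domain_def F_def[abs_def] by simp
qed

lemma continuous_on_exp: "continuous_on {0..} (\<lambda>l::real. exp (r * l))"
  by (intro continuous_intros)

lemma E_exp_op:
  assumes "x \<in> exp_dom E r" "0 \<le> b"
  shows "E b (exp_op E r x) = spectral_integral_upto E (\<lambda>l. exp (r * l)) b x"
  unfolding exp_op_def
  by (rule E_spectral_integral) (use assms in \<open>simp_all add: exp_dom_def continuous_on_exp\<close>)

lemma exp_le_1: "r \<le> 0 \<Longrightarrow> 0 \<le> l \<Longrightarrow> \<bar>exp (r * l)\<bar> \<le> (1::real)"
  by (simp add: mult_nonpos_nonneg)

lemma exp_dom_nonpos: "r \<le> 0 \<Longrightarrow> x \<in> exp_dom E r"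
  unfolding exp_dom_def by (rule bounded_spectral_domain[of _ 1]) (rule exp_le_1)

lemma norm_exp_op_le:
  assumes "r \<le> 0"
  shows "norm (exp_op E r x) \<le> norm x"
proof (rule norm_le_E)
  fix b :: real assume "0 < b"
  then show "norm (E b (exp_op E r x)) \<le> norm x"
    using norm_upto_le[of b "\<lambda>l. exp (r * l)" 1 x] exp_le_1[OF assms]
    by (simp only: E_exp_op[OF exp_dom_nonpos[OF assms]] less_imp_le continuous_on_exp mult_1_left simp_thms)
qed

lemma exp_op_diff:
  assumes "r \<le> 0"
  shows "exp_op E r (x - y) = exp_op E r x - exp_op E r y"
proof (rule E_eqI)
  fix b :: real assume "0 < b"
  then show "E b (exp_op E r (x - y)) = E b (exp_op E r x - exp_op E r y)"
    by (simp add: E_diff E_exp_op[OF exp_dom_nonpos[OF assms]] upto_diff continuous_on_exp)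
qed

text \<open>Strong continuity of the semigroup: the squared distance is at most the integral of the
  squared difference of the exponentials, to which dominated convergence applies.\<close>

lemma exp_op_tendsto:
  assumes q: "\<And>n::nat. q n \<le> 0" and r: "r \<le> 0" and lim: "q \<longlonglongrightarrow> r"
  shows "(\<lambda>n. exp_op E (q n) x) \<longlonglongrightarrow> exp_op E r x"
proof -
  \<comment> \<open>The indicator discards negative l, where the exponentials can exceed 1; on the
    half-line both lie in (0,1], hence the majorant 1.\<close>
  define w where "w n l = indicator {0..} l * (exp (q n * l) - exp (r * l))" for n l
  have w1: "\<bar>w n l\<bar> \<le> 1" for n l
  proof (cases "0 \<le> l")
    case True
    then show ?thesis using exp_le_1[OF q[of n] True] exp_le_1[OF r True]
        exp_gt_zero[of "q n * l"] exp_gt_zero[of "r * l"] unfolding w_def by (simp only: indicator_simps atLeast_iff mult_1_left)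
  qed (simp add: w_def)
  have [measurable]: "w n \<in> borel_measurable borel" for n
    unfolding w_def[abs_def] by measurable
  have bound: "(norm (exp_op E (q n) x - exp_op E r x))\<^sup>2 \<le> (\<integral>l. (w n l)\<^sup>2 \<partial>\<mu> x)" for n
  proof -
    have "norm (exp_op E (q n) x - exp_op E r x) \<le> sqrt (\<integral>l. (w n l)\<^sup>2 \<partial>\<mu> x)"
    proof (rule norm_le_E)
      fix b :: real assume b: "0 < b"
      have s: "dE_integral x (\<lambda>l. exp (q n * l) * indicator {0..b} l - exp (r * l) * indicator {0..b} l)
        (E b (exp_op E (q n) x - exp_op E r x))"
        using b unfolding E_diff E_exp_op[OF exp_dom_nonpos[OF q] less_imp_le[OF b]]
          E_exp_op[OF exp_dom_nonpos[OF r] less_imp_le[OF b]]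
        by (intro dE_integral_diff dE_integral_upto continuous_on_exp) auto
      have "(norm (E b (exp_op E (q n) x - exp_op E r x)))\<^sup>2 \<le> (\<integral>l. (w n l)\<^sup>2 \<partial>\<mu> x)"
        by (rule norm_dE_integral_le[OF s _ _ w1]) (auto simp: w_def indicator_def)
      then show "norm (E b (exp_op E (q n) x - exp_op E r x)) \<le> sqrt (\<integral>l. (w n l)\<^sup>2 \<partial>\<mu> x)"
        by (rule real_le_rsqrt)
    qed
    from power_mono[OF this norm_ge_zero, of 2] show ?thesis by simp
  qed
  have "(\<lambda>n. \<integral>l. (w n l)\<^sup>2 \<partial>\<mu> x) \<longlonglongrightarrow> (\<integral>l. 0 \<partial>\<mu> x)"
  proof (rule integral_dominated_convergence[where w="\<lambda>_. 1"])
    show "integrable (\<mu> x) (\<lambda>_. 1 :: real)" by (intro integrable_bounded[of _ 1]) auto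
    show "AE l in \<mu> x. norm ((w n l)\<^sup>2) \<le> 1" for n
      using w1 by (intro AE_I2) (simp add: abs_square_le_1)
    have "(\<lambda>n. (w n l)\<^sup>2) \<longlonglongrightarrow> (indicator {0..} l * (exp (r * l) - exp (r * l)))\<^sup>2" for l
      unfolding w_def by (intro tendsto_intros lim)
    then show "AE l in \<mu> x. (\<lambda>n. (w n l)\<^sup>2) \<longlonglongrightarrow> 0" by (intro AE_I2) simp
  qed auto
  then have w0: "(\<lambda>n. \<integral>l. (w n l)\<^sup>2 \<partial>\<mu> x) \<longlonglongrightarrow> 0" by simp
  have "(\<lambda>n. (norm (exp_op E (q n) x - exp_op E r x))\<^sup>2) \<longlonglongrightarrow> 0"
    by (rule tendsto_sandwich[OF always_eventually always_eventually tendsto_const w0])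
       (intro allI zero_le_power2 bound)+
  then have "(\<lambda>n. norm (exp_op E (q n) x - exp_op E r x)) \<longlonglongrightarrow> 0"
    by (simp add: power_tendsto_0_iff)
  then have "(\<lambda>n. exp_op E (q n) x - exp_op E r x) \<longlonglongrightarrow> 0"
    by (rule tendsto_norm_zero_cancel)
  then show ?thesis by (rule LIM_zero_cancel)
qed

text \<open>After applying \<open>E b\<close>, both sides are integrals over (\<beta>,b] of the
  bounded functions \<open>h \<beta>\<close> and \<open>h l\<close>, compared pointwise by
  monotonicity.\<close>

lemma truncation_error:
  assumes u: "u \<in> spectral_domain E h" and cont: "continuous_on {0..} h" and mono: "mono_on {0..} h"
    and pos: "\<forall>l\<ge>0. h l > 0" and \<beta>: "0 \<le> \<beta>"
  shows "h \<beta> * norm (u - E \<beta> u) \<le> norm (spectral_integral E h u)"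
proof -
  let ?v = "spectral_integral E h u"
  have h\<beta>: "0 < h \<beta>" using pos \<beta> by simp
  have "norm (h \<beta> *\<^sub>R (u - E \<beta> u)) \<le> norm ?v"
  proof (rule norm_le_E)
    fix b :: real assume b: "0 < b"
    show "norm (E b (h \<beta> *\<^sub>R (u - E \<beta> u))) \<le> norm ?v"
    proof (cases "\<beta> \<le> b")
      case False
      then show ?thesis by (simp add: E_scaleR E_diff E_E min_def E_zero)
    next
      case True
      \<comment> \<open>This equals h on (\<beta>,b] and 0 elsewhere; the difference form matches
        \<open>E b ?v - E \<beta> ?v\<close>.\<close>
      let ?w = "\<lambda>l. h l * indicator {0..b} l - h l * indicator {0..\<beta>} l"
      have sw: "dE_integral u ?w (E b ?v - E \<beta> ?v)"
        unfolding E_spectral_integral[OF u cont \<beta>] E_spectral_integral[OF u cont less_imp_le[OF b]]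
        using b \<beta> cont by (intro dE_integral_diff dE_integral_upto) auto
      have "dE_integral u (\<lambda>l. h \<beta> * indicator {\<beta><..b} l) (h \<beta> *\<^sub>R (E b u - E \<beta> u))"
        by (rule dE_integralI[where s="\<lambda>_ l. h \<beta> * indicator {\<beta><..b} l" and C="\<bar>h \<beta>\<bar>"])
           (rule step_single[OF True], simp_all add: indicator_def)
      then have "(norm (h \<beta> *\<^sub>R (E b u - E \<beta> u)))\<^sup>2 \<le> (\<integral>l. (?w l)\<^sup>2 \<partial>\<mu> u)"
      proof (rule norm_dE_integral_le)
        show "\<bar>h \<beta> * indicator {\<beta><..b} l\<bar> \<le> \<bar>?w l\<bar>" for l
          using monotone_onD[OF mono, of \<beta> l] \<beta> h\<beta> by (auto simp: indicator_def)
        show "\<bar>?w l\<bar> \<le> h b" for l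
        proof (cases "l \<in> {\<beta><..b}")
          case True
          then have "0 < h l" "h l \<le> h b" using pos \<beta> monotone_onD[OF mono, of l b] by auto
          then show ?thesis using True by (simp add: indicator_def)
        next
          case False
          have "0 < h b" using pos b by simp
          then show ?thesis using False True by (auto simp: indicator_def)
        qed
      qed (rule dE_integral_measurable[OF sw])
      also have "\<dots> = (norm (E b ?v - E \<beta> ?v))\<^sup>2" by (rule dE_integral_norm[OF sw, symmetric])
      finally have "norm (h \<beta> *\<^sub>R (E b u - E \<beta> u)) \<le> norm (E b ?v - E \<beta> ?v)"
        by (rule power2_le_imp_le) simp
      also have "E b ?v - E \<beta> ?v = E b ?v - E \<beta> (E b ?v)"
        using True by (simp add: E_E min_def)
      also have "norm \<dots> \<le> norm ?v"
        using norm_complement_le norm_E_le order_trans by blast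
      finally show ?thesis using True by (simp add: E_scaleR E_diff E_E min_absorb2)
    qed
  qed
  then show ?thesis using h\<beta> by simp
qed

end

section \<open>The regularized solution\<close>

text \<open>The data are given on {0..\<tau>}, but \<open>final_psi\<close> integrates over
  {t..\<tau>}.\<close>

lemma L1_function_subset:
  fixes f :: "'b::euclidean_space \<Rightarrow> 'a::real_normed_vector"
  assumes f: "L1_function (lebesgue_on S) f" and TS: "T \<subseteq> S" and meas: "S \<in> sets lebesgue" "T \<in> sets lebesgue"
  shows "L1_function (lebesgue_on T) f"
    and "(\<integral>\<^sup>+x. ennreal (norm (f x)) \<partial>lebesgue_on T) \<le> (\<integral>\<^sup>+x. ennreal (norm (f x)) \<partial>lebesgue_on S)"
proof -
  obtain s where s: "\<forall>i. simple_function (lebesgue_on S) (s i)" and lim: "AE x in lebesgue_on S. (\<lambda>i. s i x) \<longlonglongrightarrow> f x"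
    using f unfolding L1_function_def strongly_measurable_def by blast
  have "simple_function (lebesgue_on T) (s i)" for i
  proof -
    have "finite (s i ` space (lebesgue_on S))" and meas: "s i \<in> lebesgue_on S \<rightarrow>\<^sub>M count_space UNIV"
      using s[rule_format, of i] unfolding simple_function_eq_measurable by blast+
    then have "finite (s i ` S)" by simp
    then have "finite (s i ` T)" by (rule finite_subset[OF image_mono[OF TS]])
    then show ?thesis
      unfolding simple_function_eq_measurable
      using measurable_restrict_mono[OF meas TS] by simp
  qed
  moreover have "AE x in lebesgue_on T. (\<lambda>i. s i x) \<longlonglongrightarrow> f x"
    using lim unfolding AE_restrict_space_iff[of S lebesgue, simplified, OF meas(1)]
      AE_restrict_space_iff[of T lebesgue, simplified, OF meas(2)]
    by eventually_elim (use TS in blast)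
  ultimately have sm: "strongly_measurable (lebesgue_on T) f"
    unfolding strongly_measurable_def by blast
  show le: "(\<integral>\<^sup>+x. ennreal (norm (f x)) \<partial>lebesgue_on T) \<le> (\<integral>\<^sup>+x. ennreal (norm (f x)) \<partial>lebesgue_on S)"
    unfolding nn_integral_restrict_space[of S lebesgue, simplified, OF meas(1)]
      nn_integral_restrict_space[of T lebesgue, simplified, OF meas(2)]
    using TS by (intro nn_integral_mono mult_left_mono) (auto simp: indicator_def)
  also have "\<dots> < \<infinity>" using f by (simp add: L1_function_def)
  finally show "L1_function (lebesgue_on T) f" using sm by (simp add: L1_function_def)
qed

lemma finite_measure_lebesgue_on_Icc: "finite_measure (lebesgue_on {a..b::real})"
  by (intro finite_measureI, cases "a \<le> b") (simp_all add: emeasure_restrict_space)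

section \<open>Propagation of the noise and the error for a given cutoff\<close>

context identity_resolution
begin

text \<open>Rounding the parameter of the semigroup down to multiples of \<open>1/(i+1)\<close> turns approximating
  simple functions of \<open>f\<close> into approximating simple functions of the integrand.\<close>

lemma L1_function_exp_op:
  assumes f: "L1_function (lebesgue_on {t..\<tau>}) f"
  shows "L1_function (lebesgue_on {t..\<tau>}) (\<lambda>s. exp_op E (- (\<tau> - s)) (f s))"
proof -
  let ?M = "lebesgue_on {t..\<tau>}"
  obtain u where u: "\<forall>i. simple_function ?M (u i)" and lim: "AE s in ?M. (\<lambda>i. u i s) \<longlonglongrightarrow> f s"
    using f unfolding L1_function_def strongly_measurable_def by blast
  define d where "d i s = real_of_int \<lfloor>s * real (Suc i)\<rfloor> / real (Suc i)" for i s
  \<comment> \<open>Rounding down, rather than to the nearest multiple, keeps the exponent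
    nonpositive up to s = \<tau>, as contractivity and linearity of the exponential require.\<close>
  have d_le: "d i s \<le> s" for i s
    unfolding d_def by (simp add: divide_le_eq del: of_nat_Suc)
  have d_ge: "s - inverse (real (Suc i)) \<le> d i s" for i s
  proof -
    have "s * real (Suc i) - 1 \<le> real_of_int \<lfloor>s * real (Suc i)\<rfloor>" by linarith
    then have "(s * real (Suc i) - 1) / real (Suc i) \<le> d i s"
      unfolding d_def by (rule divide_right_mono) simp
    then show ?thesis by (simp add: diff_divide_distrib inverse_eq_divide del: of_nat_Suc)
  qed
  have d_lim: "(\<lambda>i. d i s) \<longlonglongrightarrow> s" for s
  proof (rule tendsto_sandwich[OF _ _ _ tendsto_const])
    show "(\<lambda>i. s - inverse (real (Suc i))) \<longlonglongrightarrow> s"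
      using tendsto_diff[OF tendsto_const LIMSEQ_inverse_real_of_nat, of s] by simp
  qed (simp_all only: d_le d_ge eventually_True)
  have sd: "simple_function ?M (d i)" for i
  proof (rule simple_function_borel_measurable)
    have "d i ` {t..\<tau>} \<subseteq> (\<lambda>k. real_of_int k / real (Suc i)) ` {\<lfloor>t * real (Suc i)\<rfloor>..\<lfloor>\<tau> * real (Suc i)\<rfloor>}"
      unfolding d_def by (auto intro!: imageI floor_mono mult_right_mono simp del: of_nat_Suc)
    then show "finite (d i ` space ?M)"
      by (simp add: finite_subset)
    have "d i \<in> borel_measurable lborel"
      unfolding d_def[abs_def] by measurable
    then show "d i \<in> borel_measurable ?M"
      by (intro measurable_restrict_space1 measurable_completion)
  qed
  have "simple_function ?M (\<lambda>s. exp_op E (- (\<tau> - d i s)) (u i s))" for i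
    by (rule simple_function_compose2[OF sd u[rule_format]])
  moreover have "AE s in ?M. (\<lambda>i. exp_op E (- (\<tau> - d i s)) (u i s)) \<longlonglongrightarrow> exp_op E (- (\<tau> - s)) (f s)"
    using lim AE_space
  proof eventually_elim
    case (elim s)
    then have s: "s \<le> \<tau>" by simp
    have neg: "- (\<tau> - d i s) \<le> 0" for i using d_le[of i s] s by linarith
    \<comment> \<open>The approximant is split at f s: contractivity, uniform in the parameter,
      removes the error of u i, and strong continuity handles the moving parameter at the fixed
      vector f s.\<close>
    have "(\<lambda>i. exp_op E (- (\<tau> - d i s)) (u i s - f s)) \<longlonglongrightarrow> 0"
    proof (rule Lim_null_comparison)
      show "\<forall>\<^sub>F i in sequentially. norm (exp_op E (- (\<tau> - d i s)) (u i s - f s)) \<le> norm (u i s - f s)"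
        by (intro always_eventually allI norm_exp_op_le neg)
      show "(\<lambda>i. norm (u i s - f s)) \<longlonglongrightarrow> 0"
        using elim(1) by (simp add: tendsto_norm_zero_iff LIM_zero_iff)
    qed
    moreover have "(\<lambda>i. exp_op E (- (\<tau> - d i s)) (f s)) \<longlonglongrightarrow> exp_op E (- (\<tau> - s)) (f s)"
      using s by (intro exp_op_tendsto neg tendsto_intros d_lim) auto
    ultimately have "(\<lambda>i. exp_op E (- (\<tau> - d i s)) (u i s - f s) + exp_op E (- (\<tau> - d i s)) (f s))
        \<longlonglongrightarrow> 0 + exp_op E (- (\<tau> - s)) (f s)"
      by (rule tendsto_add)
    then show ?case by (simp only: exp_op_diff[OF neg] diff_add_cancel add_0_left)
  qed
  ultimately have sm: "strongly_measurable ?M (\<lambda>s. exp_op E (- (\<tau> - s)) (f s))"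
    unfolding strongly_measurable_def by (intro exI[of _ "\<lambda>i s. exp_op E (- (\<tau> - d i s)) (u i s)"] conjI allI)
  have "(\<integral>\<^sup>+s. ennreal (norm (exp_op E (- (\<tau> - s)) (f s))) \<partial>?M) \<le> (\<integral>\<^sup>+s. ennreal (norm (f s)) \<partial>?M)"
    by (intro nn_integral_mono ennreal_leI norm_exp_op_le) simp
  also have "\<dots> < \<infinity>" using f by (simp add: L1_function_def)
  finally show ?thesis using sm by (simp add: L1_function_def)
qed

lemma norm_final_psi_diff_le:
  assumes t: "0 \<le> t" and f: "L1_function (lebesgue_on {0..\<tau>}) f" and f': "L1_function (lebesgue_on {0..\<tau>}) f'"
  shows "norm (final_psi E \<tau> \<phi> f t - final_psi E \<tau> \<phi>' f' t)
    \<le> norm (\<phi> - \<phi>') + L1_norm (lebesgue_on {0..\<tau>}) (\<lambda>s. f s - f' s)"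
proof -
  let ?M = "lebesgue_on {t..\<tau>}" and ?N = "lebesgue_on {0..\<tau>}"
  interpret M: complete_measure ?M by (rule complete_measure_lebesgue_on) simp
  interpret N: complete_measure ?N by (rule complete_measure_lebesgue_on) simp
  define I where "I = bochner_integral ?M (\<lambda>s. exp_op E (- (\<tau> - s)) (f s))"
  define I' where "I' = bochner_integral ?M (\<lambda>s. exp_op E (- (\<tau> - s)) (f' s))"
  have sub: "{t..\<tau>} \<subseteq> {0..\<tau>}" using t by auto
  note restr = L1_function_subset[OF _ sub, simplified]
  have ff: "L1_function ?N (\<lambda>s. f s - f' s)" by (rule N.L1_function_diff[OF f f'])
  have "ennreal (norm (I - I')) \<le> (\<integral>\<^sup>+s. ennreal (norm (exp_op E (- (\<tau> - s)) (f s) - exp_op E (- (\<tau> - s)) (f' s))) \<partial>?M)"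
    unfolding I_def I'_def
    by (intro M.norm_bochner_integral_diff_le finite_measure_lebesgue_on_Icc L1_function_exp_op restr f f')
  also have "\<dots> \<le> (\<integral>\<^sup>+s. ennreal (norm (f s - f' s)) \<partial>?M)"
  proof (intro nn_integral_mono ennreal_leI)
    fix s assume "s \<in> space ?M"
    then have "- (\<tau> - s) \<le> 0" by simp
    from norm_exp_op_le[OF this, of "f s - f' s"]
    show "norm (exp_op E (- (\<tau> - s)) (f s) - exp_op E (- (\<tau> - s)) (f' s)) \<le> norm (f s - f' s)"
      by (simp only: exp_op_diff[OF \<open>- (\<tau> - s) \<le> 0\<close>])
  qed
  also have "\<dots> \<le> (\<integral>\<^sup>+s. ennreal (norm (f s - f' s)) \<partial>?N)"
    by (rule restr(2)[OF ff])
  also have "\<dots> = ennreal (L1_norm ?N (\<lambda>s. f s - f' s))"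
    by (rule N.ennreal_L1_norm[OF ff, symmetric])
  finally have "norm (I - I') \<le> L1_norm ?N (\<lambda>s. f s - f' s)"
    by (simp add: L1_norm_def ennreal_le_iff)
  moreover have "final_psi E \<tau> \<phi> f t - final_psi E \<tau> \<phi>' f' t = (\<phi> - \<phi>') - (I - I')"
    unfolding final_psi_def I_def I'_def by (simp add: algebra_simps)
  ultimately show ?thesis
    using norm_triangle_ineq4[of "\<phi> - \<phi>'" "I - I'"] by simp
qed

text \<open>The cutoff stays free here, so the Hilbert space estimate is independent of the
  inversion of \<open>xi\<close>.\<close>

lemma regularization_error:
  assumes f: "L1_function (lebesgue_on {0..\<tau>}) f" and f': "L1_function (lebesgue_on {0..\<tau>}) f'"
    and dom: "final_psi E \<tau> \<phi> f t \<in> exp_dom E \<tau>"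
    and t: "0 \<le> t" "t \<le> \<tau>"
    and cont: "continuous_on {0..} h" and mono: "mono_on {0..} h" and pos: "\<forall>l\<ge>0. h l > 0"
    and u: "mild_solution E \<tau> \<phi> f t \<in> spectral_domain E h"
    and \<rho>: "norm (spectral_integral E h (mild_solution E \<tau> \<phi> f t)) \<le> \<rho>"
    and \<delta>: "norm (\<phi> - \<phi>') + L1_norm (lebesgue_on {0..\<tau>}) (\<lambda>s. f s - f' s) \<le> \<delta>"
    and \<beta>: "0 \<le> \<beta>"
  shows "norm (mild_solution E \<tau> \<phi> f t - truncated_solution E \<tau> \<phi>' f' \<beta> t)
     \<le> \<rho> / h \<beta> + exp ((\<tau> - t) * \<beta>) * \<delta>"
proof -
  let ?u = "mild_solution E \<tau> \<phi> f t" and ?\<psi> = "final_psi E \<tau> \<phi> f t" and ?\<psi>' = "final_psi E \<tau> \<phi>' f' t"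
  let ?T = "spectral_integral_upto E (\<lambda>l. exp ((\<tau> - t) * l)) \<beta>"
  \<comment> \<open>For t and l nonnegative, exp((\<tau>-t) l) is at most exp(\<tau> l), so the
    larger exponent has the smaller domain.\<close>
  have "?\<psi> \<in> exp_dom E (\<tau> - t)"
    using dom unfolding exp_dom_def by (rule spectral_domain_mono) (use t in \<open>simp add: mult_right_mono\<close>)
  then have "E \<beta> ?u = ?T ?\<psi>"
    unfolding mild_solution_def using \<beta> by (rule E_exp_op)
  then have eq: "?u - truncated_solution E \<tau> \<phi>' f' \<beta> t = (?u - E \<beta> ?u) + ?T (?\<psi> - ?\<psi>')"
    by (simp add: truncated_solution_def upto_diff[OF \<beta> continuous_on_exp])
  have h\<beta>: "0 < h \<beta>" using pos \<beta> by simp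
  have "h \<beta> * norm (?u - E \<beta> ?u) \<le> \<rho>"
    using truncation_error[OF u cont mono pos \<beta>] \<rho> by linarith
  then have 1: "norm (?u - E \<beta> ?u) \<le> \<rho> / h \<beta>"
    using h\<beta> by (simp add: field_simps)
  have "norm (?T (?\<psi> - ?\<psi>')) \<le> exp ((\<tau> - t) * \<beta>) * norm (?\<psi> - ?\<psi>')"
    using t by (intro norm_upto_le[OF \<beta> continuous_on_exp]) (simp add: mult_left_mono)
  also have "\<dots> \<le> exp ((\<tau> - t) * \<beta>) * \<delta>"
    using order_trans[OF norm_final_psi_diff_le[OF t(1) f f'] \<delta>] by (intro mult_left_mono) auto
  finally show ?thesis
    unfolding eq using 1 norm_triangle_ineq[of "?u - E \<beta> ?u" "?T (?\<psi> - ?\<psi>')"] by linarith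
qed

end

section \<open>The choice of the truncation parameter\<close>

locale weight =
  fixes \<tau> t :: real and h :: "real \<Rightarrow> real"
  assumes t: "t < \<tau>" and cont: "continuous_on {0..} h" and mono: "mono_on {0..} h"
    and pos: "\<forall>l\<ge>0. h l > 0" and lim: "filterlim h at_top at_top"
begin

text \<open>h need not be strictly increasing; strictness comes from the exponential because t <
  \<tau>.\<close>

lemma xi_less:
  assumes "0 \<le> l" "l < m"
  shows "xi \<tau> t h l < xi \<tau> t h m"
proof -
  have "h l \<le> h m" using monotone_onD[OF mono] assms by auto
  moreover have "exp ((\<tau> - t) * l) < exp ((\<tau> - t) * m)" using t assms by simp
  moreover have "0 < h m" using pos assms by simp
  ultimately have "h l * exp ((\<tau> - t) * l) \<le> h m * exp ((\<tau> - t) * l)"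
    "h m * exp ((\<tau> - t) * l) < h m * exp ((\<tau> - t) * m)" by simp_all
  then show ?thesis unfolding xi_def by linarith
qed

lemma inj_on_xi: "inj_on (xi \<tau> t h) {0<..}"
  by (rule strict_mono_on_imp_inj_on) (auto intro!: strict_mono_onI xi_less)

lemma xi_inv:
  assumes "y \<in> xi \<tau> t h ` {0<..}"
  shows "0 < xi_inv \<tau> t h y" "xi \<tau> t h (xi_inv \<tau> t h y) = y"
  using the_inv_into_into[OF inj_on_xi assms, of "{0<..}"] f_the_inv_into_f[OF inj_on_xi assms]
  by (simp_all add: xi_inv_def)

text \<open>Intermediate value theorem on [0,b] with y at most h b, which is at most
  \<open>xi\<close> at b. The value at 0 is h 0 < y, so the solution is positive.\<close>

lemma xi_range:
  assumes "h 0 < y"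
  shows "y \<in> xi \<tau> t h ` {0<..}"
proof -
  have "eventually (\<lambda>l. 0 \<le> l \<and> y \<le> h l) at_top"
    using lim by (intro eventually_conj eventually_ge_at_top) (simp add: filterlim_at_top)
  then obtain b where b: "0 \<le> b" "y \<le> h b" by (auto simp: eventually_at_top_linorder)
  have "h b \<le> xi \<tau> t h b"
    using mult_left_mono[of 1 "exp ((\<tau> - t) * b)" "h b"] pos t b by (simp add: xi_def less_imp_le)
  moreover have "continuous_on {0..b} (xi \<tau> t h)"
    unfolding xi_def[abs_def] by (intro continuous_intros continuous_on_subset[OF cont]) auto
  moreover have x0: "xi \<tau> t h 0 = h 0" by (simp add: xi_def)
  ultimately obtain l where "0 \<le> l" "xi \<tau> t h l = y"
    using IVT'[of "xi \<tau> t h" 0 y b] assms b by auto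
  moreover from this x0 assms have "l \<noteq> 0" by auto
  ultimately show ?thesis by force
qed

text \<open>If the inverse at y were below Z, strict monotonicity would put y below
  \<open>xi\<close> at |Z|. The threshold also exceeds h 0, so that y lies in the range.\<close>

lemma xi_inv_at_top: "filterlim (xi_inv \<tau> t h) at_top at_top"
  unfolding filterlim_at_top
proof
  fix Z :: real
  show "eventually (\<lambda>y. Z \<le> xi_inv \<tau> t h y) at_top"
    using eventually_gt_at_top[of "max (h 0) (xi \<tau> t h \<bar>Z\<bar>)"]
  proof eventually_elim
    case (elim y)
    then have y: "y \<in> xi \<tau> t h ` {0<..}" by (intro xi_range) simp
    show ?case
    proof (rule ccontr)
      assume "\<not> Z \<le> xi_inv \<tau> t h y"
      then have "y < xi \<tau> t h \<bar>Z\<bar>"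
        using xi_less[of "xi_inv \<tau> t h y" "\<bar>Z\<bar>"] xi_inv[OF y] by simp
      with elim show False by simp
    qed
  qed
qed

end

theorem theorem10:
  fixes D :: "'a::{real_inner, banach} set" and A :: "'a \<Rightarrow> 'a" and E :: "real \<Rightarrow> 'a \<Rightarrow> 'a"
    and \<tau> t \<rho> :: real and \<phi> :: 'a and f :: "real \<Rightarrow> 'a" and h :: "real \<Rightarrow> real"
  assumes "positive_selfadjoint D A"
    and "spectral_resolution_of D A E"
    and "\<tau> > 0"
    and "L1_function (lebesgue_on {0..\<tau>}) f"
    and "\<forall>s\<in>{0..<\<tau>}. final_psi E \<tau> \<phi> f s \<in> exp_dom E \<tau>"
    and "t \<in> {0..<\<tau>}"
    and "continuous_on {0..} h" and "mono_on {0..} h" and "\<forall>l\<ge>0. h l > 0"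
    and "filterlim h at_top at_top"
    and "mild_solution E \<tau> \<phi> f t \<in> spectral_domain E h"
    and "\<rho> > 0" and "norm (spectral_integral E h (mild_solution E \<tau> \<phi> f t)) \<le> \<rho>"
  shows "(\<forall>\<delta> \<phi>' f'. \<delta> > 0 \<and> L1_function (lebesgue_on {0..\<tau>}) f' \<and>
            norm (\<phi> - \<phi>') + L1_norm (lebesgue_on {0..\<tau>}) (\<lambda>s. f s - f' s) \<le> \<delta> \<and>
            \<rho> / \<delta> \<in> xi \<tau> t h ` {0<..} \<longrightarrow>
            norm (mild_solution E \<tau> \<phi> f t
                  - truncated_solution E \<tau> \<phi>' f' (xi_inv \<tau> t h (\<rho> / \<delta>)) t)
              \<le> 2 * \<rho> / h (xi_inv \<tau> t h (\<rho> / \<delta>)))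
       \<and> (\<forall>(\<phi>' :: real \<Rightarrow> 'a) (f' :: real \<Rightarrow> real \<Rightarrow> 'a).
            (\<forall>\<delta>>0. L1_function (lebesgue_on {0..\<tau>}) (f' \<delta>) \<and>
               norm (\<phi> - \<phi>' \<delta>) + L1_norm (lebesgue_on {0..\<tau>}) (\<lambda>s. f s - f' \<delta> s) \<le> \<delta>) \<longrightarrow>
            ((\<lambda>\<delta>. norm (mild_solution E \<tau> \<phi> f t
                  - truncated_solution E \<tau> (\<phi>' \<delta>) (f' \<delta>) (xi_inv \<tau> t h (\<rho> / \<delta>)) t))
              \<longlongrightarrow> 0) (at_right 0))"
proof -
  interpret identity_resolution E
    by standard (use assms(2) in \<open>simp add: spectral_resolution_of_def\<close>)
  interpret weight \<tau> t h
    by standard (use assms(6-10) in auto)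
  let ?\<beta> = "\<lambda>\<delta>. xi_inv \<tau> t h (\<rho> / \<delta>)"
  have bound: "norm (mild_solution E \<tau> \<phi> f t - truncated_solution E \<tau> \<phi>' f' (?\<beta> \<delta>) t) \<le> 2 * \<rho> / h (?\<beta> \<delta>)"
    if \<delta>: "\<delta> > 0" and f': "L1_function (lebesgue_on {0..\<tau>}) f'"
      and le: "norm (\<phi> - \<phi>') + L1_norm (lebesgue_on {0..\<tau>}) (\<lambda>s. f s - f' s) \<le> \<delta>"
      and ran: "\<rho> / \<delta> \<in> xi \<tau> t h ` {0<..}" for \<delta> \<phi>' f'
  proof -
    have \<beta>: "0 \<le> ?\<beta> \<delta>" and xi: "h (?\<beta> \<delta>) * exp ((\<tau> - t) * ?\<beta> \<delta>) = \<rho> / \<delta>"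
      using xi_inv[OF ran] by (simp_all add: xi_def)
    have "0 < h (?\<beta> \<delta>)" using pos \<beta> by simp
    then have "exp ((\<tau> - t) * ?\<beta> \<delta>) * \<delta> = \<rho> / h (?\<beta> \<delta>)"
      using xi \<delta> by (simp add: field_simps)
    moreover have "norm (mild_solution E \<tau> \<phi> f t - truncated_solution E \<tau> \<phi>' f' (?\<beta> \<delta>) t)
        \<le> \<rho> / h (?\<beta> \<delta>) + exp ((\<tau> - t) * ?\<beta> \<delta>) * \<delta>"
      using assms(5,6) by (intro regularization_error[OF assms(4) f' _ _ _ cont mono pos assms(11,13) le \<beta>]) auto
    ultimately show ?thesis by simp
  qed
  have "((\<lambda>\<delta>. norm (mild_solution E \<tau> \<phi> f t - truncated_solution E \<tau> (\<phi>' \<delta>) (f' \<delta>) (?\<beta> \<delta>) t)) \<longlongrightarrow> 0) (at_right 0)"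
    if noise: "\<forall>\<delta>>0. L1_function (lebesgue_on {0..\<tau>}) (f' \<delta>) \<and>
         norm (\<phi> - \<phi>' \<delta>) + L1_norm (lebesgue_on {0..\<tau>}) (\<lambda>s. f s - f' \<delta> s) \<le> \<delta>"
    for \<phi>' :: "real \<Rightarrow> 'a" and f' :: "real \<Rightarrow> real \<Rightarrow> 'a"
  proof (rule tendsto_sandwich[OF _ _ tendsto_const])
    have inf: "filterlim (\<lambda>\<delta>. \<rho> / \<delta>) at_top (at_right 0)"
      unfolding divide_inverse
      by (rule filterlim_tendsto_pos_mult_at_top[OF tendsto_const assms(12) filterlim_inverse_at_top_right])
    have pos\<delta>: "eventually (\<lambda>\<delta>::real. 0 < \<delta>) (at_right 0)" by (rule eventually_at_right_less)
    \<comment> \<open>For small \<delta> the quotient lies in the range of \<open>xi\<close>, where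
      \<open>xi_inv\<close> is a genuine inverse; so the limit carries no range hypothesis.\<close>
    have "eventually (\<lambda>\<delta>. h 0 < \<rho> / \<delta>) (at_right 0)"
      using inf by (simp add: filterlim_at_top_dense)
    with pos\<delta> show "eventually (\<lambda>\<delta>. norm (mild_solution E \<tau> \<phi> f t - truncated_solution E \<tau> (\<phi>' \<delta>) (f' \<delta>) (?\<beta> \<delta>) t)
        \<le> 2 * \<rho> / h (?\<beta> \<delta>)) (at_right 0)"
      by eventually_elim (use noise in \<open>auto intro!: bound xi_range\<close>)
    \<comment> \<open>As \<delta> decreases to 0, \<rho>/\<delta>, then the cutoff, then h of the
      cutoff tend to infinity.\<close>
    have "filterlim (\<lambda>\<delta>. h (?\<beta> \<delta>)) at_top (at_right 0)"
      by (rule filterlim_compose[OF lim filterlim_compose[OF xi_inv_at_top inf]])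
    then show "((\<lambda>\<delta>. 2 * \<rho> / h (?\<beta> \<delta>)) \<longlongrightarrow> 0) (at_right 0)"
      by (intro tendsto_divide_0[OF tendsto_const] filterlim_at_top_imp_at_infinity)
  qed simp
  with bound show ?thesis by blast
qed

end
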